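(* Let $\Sigma_3=\{x,y,z\}$. The collection $\Phi_3$ consisting of the following formulas with reversal is a $3$-avoidance basis for formulas with reversal (over $\Sigma_3$): (i) $xx$, $\ x x^R$, $\ xyx\cdot yxy$, $\ xy\cdot yx\cdot x^R\cdot y^R$, $\ xy\cdot y x^R\cdot y^R$, $\ xy\cdot y^R x^R$, $\ xyx\cdot y^R$; (ii) $xy\cdot xz\cdot y^R z$, $\ x y^R\cdot y z^R\cdot z x^R$; (iii) $xyzyx\cdot zyxyz$, $\ xyzyx\cdot zyx y^R z$, $\ xyzyx\cdot z y^R xyz$, $\ xyzyx\cdot z y^R x y^R z$, $\ xyz y^R x\cdot zyx y^R z$, $\ xyz y^R x\cdot z y^R xyz$; (iv) $xy\cdot xz\cdot yz\cdot y^R$, $\ xy\cdot xz\cdot y^R z^R$, $\ yx\cdot zx\cdot z^R y^R$, $\ xy\cdot xz\cdot y z^R\cdot y^R$, $\ yx\cdot zx\cdot z^R y\cdot y^R$, $\ xy\cdot x^R z^R\cdot yz\cdot y^R$, $\ xy\cdot x^R z^R\cdot y^R z$; (v) $xyzx\cdot yzxy\cdot zxyz$, $\ xyzx\cdot yzxy\cdot zyz$, $\ xzyx\cdot yxzy\cdot zyz$, $\ xyzx\cdot yzxy\cdot z^R$, $\ xyzx\cdot y z^R xy$; (vi) $xy\cdot xz\cdot yx\cdot zx\cdot zy$, $\ xy\cdot yz\cdot zx\cdot x^R\cdot y^R\cdot z^R$, $\ xy\cdot yz\cdot z x^R\cdot y^R\cdot z^R$, $\ xy\cdot yz\cdot z^R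 x^R\cdot y^R$, $\ xyzx\cdot y^R\cdot z^R$.
   Context: For a set $\Sigma$ of variables let $\Sigma^R=\{x^R: x\in\Sigma\}$ be a disjoint copy, with $(x^R)^R=x$. A pattern with reversal over $\Sigma$ is a finite word over $\Sigma\cup\Sigma^R$; a formula with reversal over $\Sigma$ is a finite set of such patterns, called its fragments, and the set $\{p_1,\dots,p_n\}$ is written $p_1\cdot p_2\cdot\ldots\cdot p_n$. A pattern is a factor of a formula if it is a factor (contiguous subword) of some fragment of it. Avoidability: for an alphabet $A$, a morphism $f:(\Sigma\cup\Sigma^R)^*\to A^*$ respects reversal if $f(x^R)$ is the reversal (mirror image) of the word $f(x)$ for every $x\in\Sigma$. A formula with reversal $\phi$ occurs in a word $w$ if there is a non-erasing morphism $f$ respecting reversal such that $f(p)$ is a factor of $w$ for every fragment $p$ of $\phi$; otherwise $w$ avoids $\phi$. $\phi$ is $k$-avoidable if infinitely many words over a $k$-letter alphabet avoid $\phi$, and avoidable if it is $k$-avoidable for some $k$; otherwise it is unavoidable. e-division: a morphism $h:(\Sigma\cup\Sigma^R)^*\to(\Sigma\cup\Sigma^R)^*$ respects d-reversal if for all $x\in\Sigma$, writing $h(x)=a_1a_2\cdots a_m$ with $a_i\in\Sigma\cup\Sigma^R$, one has $h(x^R)=a_m^R\cdots a_2^Ra_1^R$. $\phi$ e-divides $\psi$ if there is an injective morphism $h$ respecting d-reversal with $|h(x)|=1$ for all $x\in\Sigma\cup\Sigma^R$ such that $h(p)$ is a factor of $\psi$ for every fragment $p$ of $\phi$. $n$-avoidance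 basis: for an alphabet $\Sigma_n$ of $n$ variables, a set $\Phi$ of avoidable formulas with reversal over $\Sigma_n$ is an $n$-avoidance basis for formulas with reversal if (i) for every avoidable formula with reversal $\psi$ over $\Sigma_n$ there is some $\phi\in\Phi$ that e-divides $\psi$, and (ii) for all $\phi_1,\phi_2\in\Phi$, if $\phi_1$ e-divides $\phi_2$ then $\phi_1=\phi_2$. *)

theory Defs
  imports Main "HOL-Library.Sublist" "HOL-Library.Cardinality"
begin

text \<open>
  The variable alphabet \<open>\<Sigma>\<close> is the type \<open>'v\<close>; \<open>'v letter\<close> is the disjoint union
  of \<open>\<Sigma>\<close> (constructor \<open>Var\<close>) and its copy \<open>\<Sigma>\<^sup>R\<close> (constructor \<open>Rev\<close>).
\<close>

datatype 'v letter = Var 'v | Rev 'v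

fun bar :: "'v letter \<Rightarrow> 'v letter" where
  "bar (Var x) = Rev x"
| "bar (Rev x) = Var x"

type_synonym 'v pattern = "'v letter list"

text \<open>A formula is a \<^emph>\<open>finite\<close> set of patterns; finiteness is the predicate \<open>is_formula\<close>.\<close>

type_synonym 'v formula = "'v pattern set"

definition is_formula :: "'v formula \<Rightarrow> bool" where
  "is_formula \<phi> \<longleftrightarrow> finite \<phi>"

text \<open>The library constant \<open>sublist\<close> is the contiguous-subword (factor) relation.\<close>

definition factor_of_formula :: "'v pattern \<Rightarrow> 'v formula \<Rightarrow> bool" where
  "factor_of_formula p \<phi> \<longleftrightarrow> (\<exists>q\<in>\<phi>. sublist p q)"

text \<open>Monoid morphisms of free monoids; \<open>f [] = []\<close> follows by cancellation.\<close>

definition word_morphism :: "('a list \<Rightarrow> 'b list) \<Rightarrow> bool" where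
  "word_morphism f \<longleftrightarrow> (\<forall>u v. f (u @ v) = f u @ f v)"

definition non_erasing :: "('a list \<Rightarrow> 'b list) \<Rightarrow> bool" where
  "non_erasing f \<longleftrightarrow> (\<forall>a. f [a] \<noteq> [])"

definition respects_reversal :: "('v pattern \<Rightarrow> 'a list) \<Rightarrow> bool" where
  "respects_reversal f \<longleftrightarrow> (\<forall>x. f [Rev x] = rev (f [Var x]))"

definition respects_d_reversal :: "('v pattern \<Rightarrow> 'v pattern) \<Rightarrow> bool" where
  "respects_d_reversal h \<longleftrightarrow> (\<forall>x. h [Rev x] = rev (map bar (h [Var x])))"

definition occurs_in :: "'a set \<Rightarrow> 'v formula \<Rightarrow> 'a list \<Rightarrow> bool" where
  "occurs_in A \<phi> w \<longleftrightarrow>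
     (\<exists>f :: 'v pattern \<Rightarrow> 'a list.
        word_morphism f \<and> range f \<subseteq> lists A \<and> non_erasing f \<and> respects_reversal f \<and>
        (\<forall>p\<in>\<phi>. sublist (f p) w))"

definition avoids :: "'a set \<Rightarrow> 'a list \<Rightarrow> 'v formula \<Rightarrow> bool" where
  "avoids A w \<phi> \<longleftrightarrow> \<not> occurs_in A \<phi> w"

text \<open>The \<open>k\<close>-letter alphabet is taken to be \<open>{0, \<dots>, k - 1}\<close>.\<close>

definition k_avoidable :: "nat \<Rightarrow> 'v formula \<Rightarrow> bool" where
  "k_avoidable k \<phi> \<longleftrightarrow> infinite {w \<in> lists {..<k}. avoids {..<k} w \<phi>}"

definition avoidable :: "'v formula \<Rightarrow> bool" where
  "avoidable \<phi> \<longleftrightarrow> (\<exists>k. k_avoidable k \<phi>)"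

definition e_divides :: "'v formula \<Rightarrow> 'v formula \<Rightarrow> bool" where
  "e_divides \<phi> \<psi> \<longleftrightarrow>
     (\<exists>h :: 'v pattern \<Rightarrow> 'v pattern.
        word_morphism h \<and> inj h \<and> respects_d_reversal h \<and>
        (\<forall>a. length (h [a]) = 1) \<and>
        (\<forall>p\<in>\<phi>. factor_of_formula (h p) \<psi>))"

definition avoidance_basis :: "nat \<Rightarrow> ('v::finite) formula set \<Rightarrow> bool" where
  "avoidance_basis n \<Phi> \<longleftrightarrow>
     CARD('v) = n \<and>
     (\<forall>\<phi>\<in>\<Phi>. is_formula \<phi> \<and> avoidable \<phi>) \<and>
     (\<forall>\<psi> :: 'v formula. is_formula \<psi> \<and> avoidable \<psi> \<longrightarrow> (\<exists>\<phi>\<in>\<Phi>. e_divides \<phi> \<psi>)) \<and>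
     (\<forall>\<phi>\<^sub>1\<in>\<Phi>. \<forall>\<phi>\<^sub>2\<in>\<Phi>. e_divides \<phi>\<^sub>1 \<phi>\<^sub>2 \<longrightarrow> \<phi>\<^sub>1 = \<phi>\<^sub>2)"

datatype var3 = X | Y | Z

lemma UNIV_var3: "(UNIV :: var3 set) = {X, Y, Z}"
  using var3.exhaust by auto

instance var3 :: finite
  by standard (simp add: UNIV_var3)

definition Phi3 :: "var3 formula set" where
  "Phi3 =
    (let x = Var X; y = Var Y; z = Var Z; x' = Rev X; y' = Rev Y; z' = Rev Z in
     {
       {[x,x]},
       {[x,x']},
       {[x,y,x], [y,x,y]},
       {[x,y], [y,x], [x'], [y']},
       {[x,y], [y,x'], [y']},
       {[x,y], [y',x']},
       {[x,y,x], [y']}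
     } \<union> {
       {[x,y], [x,z], [y',z]},
       {[x,y'], [y,z'], [z,x']}
     } \<union> {
       {[x,y,z,y,x], [z,y,x,y,z]},
       {[x,y,z,y,x], [z,y,x,y',z]},
       {[x,y,z,y,x], [z,y',x,y,z]},
       {[x,y,z,y,x], [z,y',x,y',z]},
       {[x,y,z,y',x], [z,y,x,y',z]},
       {[x,y,z,y',x], [z,y',x,y,z]}
     } \<union> {
       {[x,y], [x,z], [y,z], [y']},
       {[x,y], [x,z], [y',z']},
       {[y,x], [z,x], [z',y']},
       {[x,y], [x,z], [y,z'], [y']},
       {[y,x], [z,x], [z',y], [y']},
       {[x,y], [x',z'], [y,z], [y']},
       {[x,y], [x',z'], [y',z]}
     } \<union> {
       {[x,y,z,x], [y,z,x,y], [z,x,y,z]},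
       {[x,y,z,x], [y,z,x,y], [z,y,z]},
       {[x,z,y,x], [y,x,z,y], [z,y,z]},
       {[x,y,z,x], [y,z,x,y], [z']},
       {[x,y,z,x], [y,z',x,y]}
     } \<union> {
       {[x,y], [x,z], [y,x], [z,x], [z,y]},
       {[x,y], [y,z], [z,x], [x'], [y'], [z']},
       {[x,y], [y,z], [z,x'], [y'], [z']},
       {[x,y], [y,z], [z',x'], [y']},
       {[x,y,z,x], [y'], [z']}
     })"

end

theory Submission
  imports Defs
begin

text \<open>
  Call a variable two-way in a formula if it occurs both plain and reversed, and forget the reversal
  marks. Every formula of the list then contains one of thirteen plain formulas with prescribed
  two-way variables, and all thirteen are absent from a single infinite word \<open>\<omega>\<close> over 25 letters,
  the fixed point of a morphism of length 5. No reversal of a factor of \<open>\<omega>\<close> of length at least 2 is a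
  factor of \<open>\<omega>\<close>, so two-way variables are mapped to single letters. An occurrence in \<open>\<omega>\<close> can be
  desubstituted to a shorter one. Variables may become empty then, but if \<open>xux\<close> occurs, the image of
  \<open>xu\<close> has length divisible by 5 and stays nonempty; this leads to an infinite descent.

  Conversely, a formula divided by no member of the list contains none of the thirteen plain
  formulas. A finite search shows that such a formula is mapped by some substitution into a
  Zimin-like template: \<open>XYZ\<close>, \<open>XYZXY\<close> or \<open>XYXZXYX\<close> for three, two or at most one two-way variables,
  which are sent to single letters. Every long word over a finite alphabet contains an
  instance of each template, so the formula is unavoidable.
\<close>

section \<open>Letters with reversal and morphisms given by their values on letters\<close>

primrec base :: "'v letter \<Rightarrow> 'v" where
  "base (Var v) = v"
| "base (Rev v) = v"

lemma bar_bar [simp]: "bar (bar l) = l"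
  by (cases l) simp_all

lemma base_bar [simp]: "base (bar l) = base l"
  by (cases l) simp_all

lemma bar_neq [simp]: "bar l \<noteq> l" "l \<noteq> bar l"
  by (cases l, simp_all)+

lemma base_eq_iff: "base l = base m \<longleftrightarrow> l = m \<or> l = bar m"
  by (cases l; cases m) auto

lemma morphism_letters:
  assumes "word_morphism f"
  shows "f p = concat (map (\<lambda>l. f [l]) p)"
proof (induction p)
  case Nil
  have "f ([] @ []) = f [] @ f []"
    using assms unfolding word_morphism_def by blast
  then show ?case
    by simp
next
  case (Cons l p)
  have "f ([l] @ p) = f [l] @ f p"
    using assms unfolding word_morphism_def by blast
  with Cons show ?case
    by simp
qed

lemma ball_insert_distrib: "(\<forall>x\<in>insert a A. P x) \<longleftrightarrow> P a \<and> (\<forall>x\<in>A. P x)"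
  by simp

section \<open>The word and desubstitution\<close>

text \<open>
  Write a letter as \<open>5 * s + i\<close> with \<open>i, s < 5\<close>. Its image under the morphism has \<open>j\<close>-th letter
  \<open>5 * ((i + j * s) mod 5) + j\<close>: the residue mod 5 shows the position in the block, and two
  consecutive letters of a block determine first \<open>s\<close> and then \<open>i\<close>.
\<close>

fun omega :: "nat \<Rightarrow> nat" where
  "omega n =
    (if n = 0 then 0
     else 5 * ((omega (n div 5) mod 5 + (n mod 5) * (omega (n div 5) div 5)) mod 5) + n mod 5)"

declare omega.simps [simp del]

lemma omega_eq:
  "omega n = 5 * ((omega (n div 5) mod 5 + (n mod 5) * (omega (n div 5) div 5)) mod 5) + n mod 5"
  by (cases "n = 0") (simp_all add: omega.simps[of n] omega.simps[of 0])

lemma omega_mod: "omega n mod 5 = n mod 5"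
  by (subst omega_eq) simp

lemma omega_div:
  "omega n div 5 = (omega (n div 5) mod 5 + (n mod 5) * (omega (n div 5) div 5)) mod 5"
  by (subst omega_eq) simp

lemma omega_less: "omega n < 25"
proof -
  have "omega n div 5 < 5"
    by (subst omega_div) simp
  then show ?thesis
    by linarith
qed

lemma mod5_add_cancel:
  fixes a b c d :: nat
  assumes "(a + c) mod 5 = (b + d) mod 5" "a mod 5 = b mod 5"
  shows "c mod 5 = d mod 5"
proof -
  \<comment> \<open>Modulo 5, adding \<open>4 * l\<close> amounts to subtracting
    \<open>l\<close>.\<close>
  have "k mod 5 = ((l + k) mod 5 + 4 * (l mod 5)) mod 5" for k l :: nat
  proof -
    have "((l + k) mod 5 + 4 * (l mod 5)) mod 5 = (l + k + 4 * l) mod 5"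
      using mod_add_eq[of "l + k" 5 "4 * l"] mod_add_right_eq[of "(l + k) mod 5" "4 * (l mod 5)" 5]
      by (simp only: mod_mult_right_eq mod_add_right_eq)
    also have "l + k + 4 * l = k + 5 * l"
      by simp
    finally show ?thesis
      by simp
  qed
  then show ?thesis
    using assms by metis
qed

text \<open>Both letters come from one parent, at offsets \<open>r\<close> and \<open>r + 1\<close>
  of its block. The difference of the two congruences gives the quotient of the parent by 5, and the
  first congruence then gives its residue.\<close>

lemma omega_parent:
  assumes "i mod 5 \<noteq> 4" "omega i = omega j" "omega (Suc i) = omega (Suc j)"
  shows "omega (i div 5) = omega (j div 5)"
proof -
  define r where "r = i mod 5"
  define v w where "v = omega (i div 5)" and "w = omega (j div 5)"
  have r: "j mod 5 = r"
    using assms(2) omega_mod[of i] omega_mod[of j] by (simp add: r_def)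
  have S: "Suc k mod 5 = Suc r" "Suc k div 5 = k div 5" if "k mod 5 = r" for k
    using that assms(1) r_def by (simp_all add: mod_Suc div_Suc)
  have 1: "(v mod 5 + r * (v div 5)) mod 5 = (w mod 5 + r * (w div 5)) mod 5"
    using assms(2) omega_div[of i] omega_div[of j] by (simp add: v_def w_def r r_def)
  have 2: "(v mod 5 + Suc r * (v div 5)) mod 5 = (w mod 5 + Suc r * (w div 5)) mod 5"
    using assms(3) omega_div[of "Suc i"] omega_div[of "Suc j"]
    by (simp only: v_def w_def S[OF r] S[OF r_def[symmetric]])
  have "v div 5 mod 5 = w div 5 mod 5"
    by (rule mod5_add_cancel[OF _ 1]) (use 2 in \<open>simp add: algebra_simps\<close>)
  moreover have "v div 5 < 5" "w div 5 < 5"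
    using omega_less[of "i div 5"] omega_less[of "j div 5"] unfolding v_def w_def by linarith+
  ultimately have d: "v div 5 = w div 5"
    by simp
  have "v mod 5 mod 5 = w mod 5 mod 5"
    by (rule mod5_add_cancel[of "r * (w div 5)" _ "r * (w div 5)"])
      (use 1 in \<open>simp_all add: d add.commute\<close>)
  then have "v = w"
    using d by (metis div_mult_mod_eq mod_mod_trivial)
  then show ?thesis
    by (simp add: v_def w_def)
qed

section \<open>Factors of the word and their parents\<close>

definition seg :: "nat \<Rightarrow> nat \<Rightarrow> nat list" where
  "seg i n = map omega [i..<i + n]"

lemma length_seg [simp]: "length (seg i n) = n"
  by (simp add: seg_def)

lemma seg_0 [simp]: "seg i 0 = []"
  by (simp add: seg_def)

lemma nth_seg [simp]: "k < n \<Longrightarrow> seg i n ! k = omega (i + k)"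
  by (simp add: seg_def)

lemma seg_add: "seg i (m + n) = seg i m @ seg (i + m) n"
  by (rule nth_equalityI) (auto simp: nth_append)

definition fac :: "nat list \<Rightarrow> bool" where
  "fac u \<longleftrightarrow> (\<exists>i. u = seg i (length u))"

lemma fac_sublist:
  assumes "fac u" "sublist v u"
  shows "fac v"
proof -
  obtain i xs ys where "seg i (length u) = xs @ v @ ys"
    using assms unfolding fac_def sublist_def by metis
  then have "seg i (length xs + (length v + length ys)) = xs @ v @ ys"
    by (metis length_append length_seg)
  then have "seg (i + length xs) (length v) = v"
    by (simp add: seg_add)
  then show ?thesis
    by (metis fac_def)
qed

text \<open>Letters reveal positions modulo 5, so all occurrences of a nonempty factor start in one
  residue class.\<close>

lemma seg_eq_mod:
  assumes "seg i n = seg j n" "0 < n"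
  shows "i mod 5 = j mod 5"
proof -
  have "omega i = omega j"
    using assms nth_seg[of 0 n i] nth_seg[of 0 n j] by simp
  then show ?thesis
    by (metis omega_mod)
qed

text \<open>For \<open>m < 5\<close> this counts the markers \<open>5 * k + m\<close> below position
  \<open>i\<close>. A segment from \<open>i\<close> to \<open>j\<close> thus contains the markers
  with \<open>k\<close> from \<open>shrink m i\<close> up to, but excluding,
  \<open>shrink m j\<close>.\<close>

definition shrink :: "nat \<Rightarrow> nat \<Rightarrow> nat" where
  "shrink m i = (i + 4 - m) div 5"

text \<open>Equal segments start at the same offset in a block, so their markers match. The excluded
  end residue keeps the letter after each marker inside the segment, and \<open>omega_parent\<close>
  applies to every pair.\<close>

lemma seg_shrink:
  assumes eq: "seg i n = seg j n" and n: "0 < n" and m: "m < 4" and e: "(i + n) mod 5 \<noteq> Suc m"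
  shows "seg (shrink m i) (shrink m (i + n) - shrink m i) =
         seg (shrink m j) (shrink m (j + n) - shrink m j)"
proof -
  define r a b where "r = i mod 5" and "a = i div 5" and "b = j div 5"
  have i: "i = 5 * a + r"
    by (simp add: r_def a_def)
  have j: "j = 5 * b + r"
    using seg_eq_mod[OF eq n] by (simp add: r_def b_def)
  \<comment> \<open>Shifting by whole blocks commutes with \<open>shrink\<close>, so only the common
    offset \<open>r\<close> matters.\<close>
  have D: "shrink m (5 * c + k) = c + shrink m k" for c k
  proof -
    have "5 * c + k + 4 - m = 5 * c + (k + 4 - m)"
      using m by simp
    then show ?thesis
      by (simp add: shrink_def)
  qed
  define L where "L = shrink m (r + n) - shrink m r"
  have "omega (a + shrink m r + t) = omega (b + shrink m r + t)" if t: "t < L" for t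
  proof -
    define k where "k = shrink m r + t"
    have lo: "r \<le> 5 * k + m"
      unfolding k_def shrink_def using m by simp
    have "k < shrink m (r + n)"
      using t unfolding k_def L_def by simp
    then have "5 * k + 5 \<le> r + n + 4 - m"
      unfolding shrink_def by (simp add: less_eq_div_iff_mult_less_eq Suc_le_eq[symmetric])
    \<comment> \<open>Being counted only puts the marker inside the segment; \<open>e\<close> rules
      out that it is the last letter.\<close>
    moreover have "r + n \<noteq> 5 * k + Suc m"
    proof
      assume "r + n = 5 * k + Suc m"
      then have "(i + n) mod 5 = Suc m mod 5"
        unfolding i by (metis add.assoc mod_mult_self4)
      with e m show False
        by simp
    qed
    ultimately have hi: "5 * k + m + 2 \<le> r + n"
      using m by linarith
    define p where "p = 5 * k + m - r"
    have p: "p < n" "Suc p < n" "r + p = 5 * k + m"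
      using lo hi unfolding p_def by linarith+
    have pos: "i + p = 5 * (a + k) + m" "j + p = 5 * (b + k) + m"
      using p(3) unfolding i j by simp_all
    have "omega (i + p) = omega (j + p)"
      using nth_seg[OF p(1), of i] nth_seg[OF p(1), of j] eq by simp
    moreover have "omega (Suc (i + p)) = omega (Suc (j + p))"
      using nth_seg[OF p(2), of i] nth_seg[OF p(2), of j] eq by simp
    moreover have "(i + p) mod 5 \<noteq> 4"
      using m mod_mult_self4[of 5 "a + k" m] unfolding pos by simp
    ultimately have "omega ((i + p) div 5) = omega ((j + p) div 5)"
      using m by (intro omega_parent) simp_all
    moreover have "(i + p) div 5 = a + k" "(j + p) div 5 = b + k"
      using m unfolding pos by simp_all
    ultimately show ?thesis
      by (simp add: k_def add.assoc)
  qed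
  then have "seg (a + shrink m r) L = seg (b + shrink m r) L"
    by (intro nth_equalityI) simp_all
  then show ?thesis
    using D unfolding i j L_def by (simp add: add.assoc)
qed

lemma shrink_mono: "i \<le> j \<Longrightarrow> shrink m i \<le> shrink m j"
  by (simp add: shrink_def div_le_mono)

definition occ :: "('v \<Rightarrow> nat list) \<Rightarrow> 'v list \<Rightarrow> bool" where
  "occ g p \<longleftrightarrow> fac (concat (map g p))"

lemma occ_sublist:
  assumes "occ g p" "sublist q p"
  shows "occ g q"
proof -
  have "sublist (concat (map g q)) (concat (map g p))"
    using assms(2) unfolding sublist_def by (metis concat_append map_append)
  then show ?thesis
    using assms(1) fac_sublist by (auto simp: occ_def)
qed

text \<open>One \<open>g'\<close> has to serve all fragments at once. The new length is prescribed
  for multiples of 5 only, because only then does the number of markers not depend on the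
  position.\<close>

definition descends :: "('v \<Rightarrow> nat list) \<Rightarrow> ('v \<Rightarrow> nat list) \<Rightarrow> bool" where
  "descends g g' \<longleftrightarrow>
     (\<forall>p. occ g p \<longrightarrow> occ g' p) \<and>
     (\<forall>p. occ g p \<longrightarrow> 5 dvd length (concat (map g p)) \<longrightarrow>
        length (concat (map g' p)) = length (concat (map g p)) div 5) \<and>
     (\<forall>v. length (g v) \<le> 1 \<longrightarrow> g' v = [])"

text \<open>
  Every image is replaced by the parents of the marker pairs (offsets \<open>m\<close>, \<open>m + 1\<close> of a block) it
  starts; as no image ends between the two letters of a marker pair, the pair lies inside the image
  and determines the parent.
\<close>

lemma ex_descends:
  fixes g :: "var3 \<Rightarrow> nat list"
  shows "\<exists>g'. descends g g'"
proof -
  define P where "P v = (SOME i. g v = seg i (length (g v)))" for v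
  have P: "g v = seg (P v) (length (g v))" if "fac (g v)" for v
    using that unfolding fac_def P_def by (rule someI_ex)
  define ends where "ends = (\<lambda>v. (P v + length (g v)) mod 5) ` UNIV"
  have ends: "(P v + length (g v)) mod 5 \<in> ends" for v
    unfolding ends_def by (intro image_eqI[where x = v]) simp_all
  \<comment> \<open>Three images end in at most three residues, so one of 1, 2, 3, 4 is free.
    Leaving out 0 gives \<open>m < 4\<close>, so a marker and its successor share a block.\<close>
  have "card ends \<le> card (UNIV :: var3 set)"
    unfolding ends_def by (rule card_image_le) simp
  then have "card ends < card {1..4::nat}"
    by (simp add: UNIV_var3)
  then have "\<not> {1..4} \<subseteq> ends"
    using card_mono[of ends "{1..4::nat}"] by (auto simp: ends_def)
  then obtain m' where m': "m' \<in> {1..4}" "m' \<notin> ends"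
    by blast
  define m where "m = m' - 1"
  have m: "m < 4" "Suc m \<notin> ends"
    using m' by (auto simp: m_def)
  define h where "h i n = seg (shrink m i) (shrink m (i + n) - shrink m i)" for i n
  define g' where "g' v = (if fac (g v) then h (P v) (length (g v)) else [])" for v
  have h0: "h i 0 = []" for i
    by (simp add: h_def)
  have h_add: "h i (n + k) = h i n @ h (i + n) k" for i n k
  proof -
    have "shrink m (i + (n + k)) - shrink m i =
      (shrink m (i + n) - shrink m i) + (shrink m (i + n + k) - shrink m (i + n))"
      using shrink_mono[of i "i + n" m] shrink_mono[of "i + n" "i + n + k" m] by (simp add: add.assoc)
    moreover have "shrink m i + (shrink m (i + n) - shrink m i) = shrink m (i + n)"
      using shrink_mono[of i "i + n" m] by simp
    ultimately show ?thesis
      unfolding h_def add.assoc by (metis seg_add)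
  qed
  \<comment> \<open>By \<open>seg_shrink\<close> the result does not depend on the occurrence chosen
    by \<open>P\<close>, so it can be computed along any occurrence of a longer word.\<close>
  have g': "g' v = h i (length (g v))" if "g v = seg i (length (g v))" for i v
  proof (cases "g v = []")
    case True
    then show ?thesis
      by (simp add: g'_def h0)
  next
    case False
    have fac: "fac (g v)"
      unfolding fac_def using that by blast
    have "(P v + length (g v)) mod 5 \<noteq> Suc m"
      using m(2) ends[of v] by auto
    moreover have "seg (P v) (length (g v)) = seg i (length (g v))"
      by (rule trans[OF P[OF fac, symmetric] that])
    ultimately have "h (P v) (length (g v)) = h i (length (g v))"
      unfolding h_def by (intro seg_shrink m) (simp_all only: length_greater_0_conv False not_False_eq_True)
    then show ?thesis
      using fac by (simp add: g'_def)
  qed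
  have map_g': "concat (map g' p) = h i (length (concat (map g p)))"
    if "concat (map g p) = seg i (length (concat (map g p)))" for p i
    using that
  proof (induction p arbitrary: i)
    case Nil
    then show ?case
      by (simp add: h0)
  next
    case (Cons v p)
    have "g v @ concat (map g p) =
      seg i (length (g v)) @ seg (i + length (g v)) (length (concat (map g p)))"
      using Cons.prems unfolding list.map concat.simps length_append seg_add .
    then have "g v = seg i (length (g v))"
      "concat (map g p) = seg (i + length (g v)) (length (concat (map g p)))"
      by (metis append_eq_append_conv length_seg)+
    from g'[OF this(1)] Cons.IH[OF this(2)] show ?case
      unfolding list.map concat.simps length_append h_add by (rule arg_cong2)
  qed
  have "descends g g'"
    unfolding descends_def
  proof (intro conjI allI impI)
    fix p
    assume "occ g p"
    then obtain i where i: "concat (map g p) = seg i (length (concat (map g p)))"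
      by (auto simp: occ_def fac_def)
    from map_g'[OF this] show "occ g' p"
      unfolding occ_def fac_def h_def by (metis length_seg)
  next
    fix p
    assume "occ g p"
    then obtain i where i: "concat (map g p) = seg i (length (concat (map g p)))"
      by (auto simp: occ_def fac_def)
    assume "5 dvd length (concat (map g p))"
    then obtain k where k: "length (concat (map g p)) = 5 * k"
      by (elim dvdE)
    have "shrink m (i + 5 * k) = shrink m i + k"
    proof -
      have "i + 5 * k + 4 - m = i + 4 - m + 5 * k"
        using m(1) by simp
      then show ?thesis
        by (simp add: shrink_def)
    qed
    then show "length (concat (map g' p)) = length (concat (map g p)) div 5"
      unfolding map_g'[OF i] unfolding k by (simp add: h_def)
  next
    fix v
    assume l: "length (g v) \<le> 1"
    show "g' v = []"
    proof (cases "fac (g v) \<and> g v \<noteq> []")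
      case True
      then have 1: "length (g v) = 1"
        using l by (cases "g v") auto
      have "(P v + 1) mod 5 \<noteq> Suc m"
        using m(2) ends[of v] 1 by auto
      \<comment> \<open>\<open>shrink\<close> grows after \<open>P v\<close> only if
        \<open>P v\<close> is a marker, but then the single letter would end at the excluded
        residue.\<close>
      have "Suc (P v + 4 - m) mod 5 \<noteq> 0"
      proof
        assume "Suc (P v + 4 - m) mod 5 = 0"
        then obtain k where k: "Suc (P v + 4 - m) = 5 * k"
          by (metis mod_0_imp_dvd dvdE)
        then have "P v + 1 = 5 * (k - 1) + Suc m"
          using m(1) by (cases k) simp_all
        then have "(P v + 1) mod 5 = Suc m mod 5"
          by (metis mod_mult_self4)
        with m(1) \<open>(P v + 1) mod 5 \<noteq> Suc m\<close> show False
          by simp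
      qed
      then have "shrink m (P v + 1) = shrink m (P v)"
        using div_Suc[of "P v + 4 - m" 5] Suc_diff_le[of m "P v + 4"] m(1)
        unfolding shrink_def by (simp add: add.commute)
      then have "h (P v) 1 = []"
        unfolding h_def by (simp only: diff_self_eq_0 seg_0)
      with True 1 show ?thesis
        by (simp only: g'_def if_True)
    qed (auto simp: g'_def h0)
  qed
  then show ?thesis
    by blast
qed

section \<open>Plain formulas absent from the word\<close>

text \<open>Both copies of \<open>v\<close> start in the same residue class, and their distance is
  the length of the image of \<open>v # p\<close>.\<close>

lemma occ_two_same:
  assumes "occ g (v # p @ [v])" "g v \<noteq> []"
  shows "5 dvd length (concat (map g (v # p)))"
proof -
  define n where "n = length (concat (map g (v # p)))"
  obtain i where
    "concat (map g (v # p @ [v])) = seg i (length (concat (map g (v # p @ [v]))))"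
    using assms(1) unfolding occ_def fac_def by blast
  then have "concat (map g (v # p)) @ g v = seg i (n + length (g v))"
    by (simp add: n_def add.assoc)
  then have *: "concat (map g (v # p)) @ g v = seg i n @ seg (i + n) (length (g v))"
    unfolding seg_add .
  then have "concat (map g (v # p)) = seg i n" and v: "g v = seg (i + n) (length (g v))"
    by (metis append_eq_append_conv length_seg n_def)+
  moreover have "n = length (g v) + length (concat (map g p))"
    by (simp add: n_def)
  ultimately have "g v @ concat (map g p) = seg i (length (g v)) @ seg (i + length (g v)) (length (concat (map g p)))"
    by (simp add: seg_add)
  then have "g v = seg i (length (g v))"
    by (metis append_eq_append_conv length_seg)
  with v have "seg i (length (g v)) = seg (i + n) (length (g v))"
    by (rule trans[OF sym, rotated])
  then have "i mod 5 = (i + n) mod 5"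
    by (rule seg_eq_mod) (simp add: assms(2))
  then show ?thesis
    unfolding n_def[symmetric] by (metis add_diff_cancel_left' le_add1 mod_eq_dvd_iff_nat)
qed

lemma descends_occ: "descends g g' \<Longrightarrow> occ g p \<Longrightarrow> occ g' p"
  by (simp add: descends_def)

lemma descends_short: "descends g g' \<Longrightarrow> length (g v) \<le> 1 \<Longrightarrow> g' v = []"
  by (simp add: descends_def)

lemma descends_length:
  "descends g g' \<Longrightarrow> occ g p \<Longrightarrow> 5 dvd length (concat (map g p)) \<Longrightarrow>
   length (concat (map g p)) = 5 * length (concat (map g' p))"
  by (simp add: descends_def)

lemma descends_nonempty:
  assumes "descends g g'" "occ g p" "5 dvd length (concat (map g p))" "v \<in> set p" "g v \<noteq> []"
  shows "\<exists>v\<in>set p. g' v \<noteq> []"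
proof -
  have "length (concat (map g p)) \<noteq> 0"
    using assms(4,5) by auto
  then have "length (concat (map g' p)) \<noteq> 0"
    using descends_length[OF assms(1-3)] by simp
  then show ?thesis
    by auto
qed

text \<open>By \<open>omega_mod\<close> this is the residue modulo 5 of the position at which any
  occurrence of a nonempty \<open>g v\<close> starts.\<close>

definition entry :: "('v \<Rightarrow> nat list) \<Rightarrow> 'v \<Rightarrow> nat" where
  "entry g v = hd (g v) mod 5"

lemma entry_less: "entry g v < 5"
  by (simp add: entry_def)

lemma entry_step:
  assumes "occ g [v, w]" "g v \<noteq> []" "g w \<noteq> []"
  shows "entry g w = (entry g v + length (g v)) mod 5"
proof -
  obtain i where "g v @ g w = seg i (length (g v) + length (g w))"
    using assms(1) by (auto simp: occ_def fac_def)
  then have "g v = seg i (length (g v))" "g w = seg (i + length (g v)) (length (g w))"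
    unfolding seg_add by (metis append_eq_append_conv length_seg)+
  then have "hd (g v) = omega i" "hd (g w) = omega (i + length (g v))"
    using assms(2,3) by (metis add.right_neutral hd_conv_nth length_greater_0_conv nth_seg)+
  then show ?thesis
    by (simp add: entry_def omega_mod mod_add_left_eq)
qed

lemma dvd_if_mod_fixed:
  fixes s l :: nat
  assumes "s = (s + l) mod 5"
  shows "5 dvd l"
proof -
  have "(s + l) mod 5 = s mod 5"
    using assms by (metis mod_mod_trivial)
  then show ?thesis
    by (metis add_diff_cancel_left' le_add1 mod_eq_dvd_iff_nat)
qed

text \<open>The period of a square is a multiple of 5, so desubstitution divides it by exactly 5 and
  leaves a shorter nonempty square.\<close>

lemma occ_xx:
  fixes g :: "var3 \<Rightarrow> nat list"
  assumes "occ g [x, x]"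
  shows "g x = []"
  using assms
proof (induction "length (g x)" arbitrary: g rule: less_induct)
  case less
  show ?case
  proof (rule ccontr)
    assume ne: "g x \<noteq> []"
    have 5: "5 dvd length (concat (map g [x]))"
      using occ_two_same[of g x "[]"] less.prems ne by simp
    have x: "occ g [x]"
      by (rule occ_sublist[OF less.prems]) (simp add: sublist_code)
    obtain g' where g': "descends g g'"
      using ex_descends by blast
    have l: "length (g x) = 5 * length (g' x)"
      using descends_length[OF g' x 5] by simp
    with ne have "length (g' x) < length (g x)"
      by (cases "g' x") auto
    then have "g' x = []"
      by (rule less.hyps) (rule descends_occ[OF g' less.prems])
    with l ne show False
      by simp
  qed
qed

text \<open>The length of \<open>xy\<close> is a multiple of 5, so its image cannot vanish. If one
  variable becomes empty, the other forms a square and is empty too by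
  \<open>occ_xx\<close>.\<close>

lemma occ_xyx_yxy:
  fixes g :: "var3 \<Rightarrow> nat list"
  assumes "occ g [x, y, x]" "occ g [y, x, y]"
  shows "g x = [] \<or> g y = []"
  using assms
proof (induction "length (g x) + length (g y)" arbitrary: g rule: less_induct)
  case less
  show ?case
  proof (rule ccontr)
    assume ne: "\<not> (g x = [] \<or> g y = [])"
    have 5: "5 dvd length (concat (map g [x, y]))"
      using occ_two_same[of g x "[y]"] less.prems ne by simp
    have xy: "occ g [x, y]"
      by (rule occ_sublist[OF less.prems(1)]) (simp add: sublist_code)
    obtain g' where g': "descends g g'"
      using ex_descends by blast
    note occ' = less.prems[THEN descends_occ[OF g']]
    have l: "length (g x) + length (g y) = 5 * (length (g' x) + length (g' y))"
      using descends_length[OF g' xy 5] by simp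
    have "0 < length (g x) + length (g y)"
      using ne by simp
    then have l': "0 < length (g' x) + length (g' y)"
      unfolding l nat_0_less_mult_iff by blast
    then have less': "length (g' x) + length (g' y) < length (g x) + length (g y)"
      unfolding l using mult_strict_right_mono[of 1 5 "length (g' x) + length (g' y)"] by simp
    from less.hyps[OF less' occ'] show False
    proof
      assume "g' x = []"
      moreover from this have "g' y = []"
        using occ'(2) by (intro occ_xx[of g' y]) (simp add: occ_def)
      ultimately show False
        using l' by simp
    next
      assume "g' y = []"
      moreover from this have "g' x = []"
        using occ'(1) by (intro occ_xx[of g' x]) (simp add: occ_def)
      ultimately show False
        using l' by simp
    qed
  qed
qed

text \<open>Desubstitution erases the single letter \<open>y\<close> and leaves \<open>xx\<close>,
  although the image of \<open>xy\<close> must stay nonempty.\<close>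

lemma occ_xyx_short:
  fixes g :: "var3 \<Rightarrow> nat list"
  assumes "occ g [x, y, x]" "length (g y) = 1"
  shows "g x = []"
proof (rule ccontr)
  assume ne: "g x \<noteq> []"
  obtain g' where g': "descends g g'"
    using ex_descends by blast
  have 5: "5 dvd length (concat (map g [x, y]))"
    using occ_two_same[of g x "[y]"] assms ne by simp
  have xy: "occ g [x, y]"
    by (rule occ_sublist[OF assms(1)]) (simp add: sublist_code)
  have y: "g' y = []"
    using assms(2) descends_short[OF g'] by simp
  moreover have "g' x = []"
    using descends_occ[OF g' assms(1)] y by (intro occ_xx[of g' x]) (simp add: occ_def)
  ultimately show False
    using descends_nonempty[OF g' xy 5 _ ne] by simp
qed

text \<open>Two steps of length 1 would lead back to the same residue modulo 5.\<close>

lemma occ_xy_yx_short: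
  fixes g :: "var3 \<Rightarrow> nat list"
  assumes "occ g [x, y]" "occ g [y, x]" "length (g x) = 1" "length (g y) = 1"
  shows False
proof -
  have "entry g y = (entry g x + 1) mod 5" "entry g x = (entry g y + 1) mod 5"
    using assms by (auto dest: entry_step)
  then show False
    using entry_less[of g x] by presburger
qed

text \<open>Following \<open>x\<close>, both \<open>y\<close> and \<open>z\<close> start in the same
  residue class, but \<open>z\<close> also follows \<open>y\<close>, which has length 1.\<close>

lemma occ_xy_xz_yz_short:
  fixes g :: "var3 \<Rightarrow> nat list"
  assumes "occ g [x, y]" "occ g [x, z]" "occ g [y, z]" "length (g y) = 1" "g x \<noteq> []" "g z \<noteq> []"
  shows False
proof -
  have y: "g y \<noteq> []"
    using assms(4) by auto
  have "entry g z = entry g y"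
    by (rule trans[OF entry_step[OF assms(2,5,6)] entry_step[OF assms(1,5) y, symmetric]])
  moreover have "entry g z = (entry g y + 1) mod 5"
    using entry_step[OF assms(3) y assms(6)] assms(4) by simp
  ultimately have "entry g y = (entry g y + 1) mod 5"
    by simp
  then show False
    using entry_less[of g y] by presburger
qed

lemma occ_xy_yz_zx_short:
  fixes g :: "var3 \<Rightarrow> nat list"
  assumes "occ g [x, y]" "occ g [y, z]" "occ g [z, x]"
    "length (g x) = 1" "length (g y) = 1" "length (g z) = 1"
  shows False
proof -
  have "entry g y = (entry g x + 1) mod 5" "entry g z = (entry g y + 1) mod 5"
    "entry g x = (entry g z + 1) mod 5"
    using assms by (auto dest: entry_step)
  then show False
    using entry_less[of g x] by presburger
qed

lemma occ_xyzx_short: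
  fixes g :: "var3 \<Rightarrow> nat list"
  assumes "occ g [x, y, z, x]" "length (g y) = 1" "length (g z) = 1"
  shows "g x = []"
proof (rule ccontr)
  assume ne: "g x \<noteq> []"
  obtain g' where g': "descends g g'"
    using ex_descends by blast
  have 5: "5 dvd length (concat (map g [x, y, z]))"
    using occ_two_same[of g x "[y, z]"] assms ne by simp
  have xyz: "occ g [x, y, z]"
    by (rule occ_sublist[OF assms(1)]) (simp add: sublist_code)
  have yz: "g' y = []" "g' z = []"
    using assms(2,3) descends_short[OF g'] by simp_all
  moreover have "g' x = []"
    using descends_occ[OF g' assms(1)] yz by (intro occ_xx[of g' x]) (simp add: occ_def)
  ultimately show False
    using descends_nonempty[OF g' xyz 5 _ ne] by simp
qed

text \<open>Desubstitution erases \<open>z\<close> and leaves \<open>xyx\<close> and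
  \<open>yxy\<close>.\<close>

lemma occ_xyzx_yzxy_short:
  fixes g :: "var3 \<Rightarrow> nat list"
  assumes "occ g [x, y, z, x]" "occ g [y, z, x, y]" "length (g z) = 1" "g y \<noteq> []"
  shows "g x = []"
proof (rule ccontr)
  assume ne: "g x \<noteq> []"
  obtain g' where g': "descends g g'"
    using ex_descends by blast
  have 5: "5 dvd length (concat (map g [x, y, z]))"
    using occ_two_same[of g x "[y, z]"] assms ne by simp
  have xyz: "occ g [x, y, z]"
    by (rule occ_sublist[OF assms(1)]) (simp add: sublist_code)
  have z: "g' z = []"
    using assms(3) descends_short[OF g'] by simp
  have "g' x = [] \<or> g' y = []"
    using descends_occ[OF g' assms(1)] descends_occ[OF g' assms(2)] z
    by (intro occ_xyx_yxy[of g' x y]) (simp_all add: occ_def)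
  moreover have "g' x = []" if "g' y = []"
    using descends_occ[OF g' assms(1)] z that by (intro occ_xx[of g' x]) (simp add: occ_def)
  moreover have "g' y = []" if "g' x = []"
    using descends_occ[OF g' assms(2)] z that by (intro occ_xx[of g' y]) (simp add: occ_def)
  ultimately have "g' x = [] \<and> g' y = []"
    by blast
  with z show False
    using descends_nonempty[OF g' xyz 5 _ ne] by simp
qed

text \<open>The factors \<open>yxy\<close> and \<open>yzy\<close> make the lengths of
  \<open>yx\<close> and \<open>yz\<close> multiples of 5. If \<open>y\<close> vanishes,
  \<open>xzx\<close> and \<open>zxz\<close> remain; if \<open>x\<close> or \<open>z\<close> vanishes
  and \<open>y\<close> does not, the square \<open>yy\<close> remains.\<close>

lemma occ_xyzyx_zyxyz:
  fixes g :: "var3 \<Rightarrow> nat list"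
  assumes "occ g [x, y, z, y, x]" "occ g [z, y, x, y, z]"
  shows "g x = [] \<or> g y = [] \<or> g z = []"
  using assms
proof (induction "length (g x) + length (g y) + length (g z)" arbitrary: g rule: less_induct)
  case less
  show ?case
  proof (rule ccontr)
    assume "\<not> (g x = [] \<or> g y = [] \<or> g z = [])"
    then have ne: "g x \<noteq> []" "g y \<noteq> []" "g z \<noteq> []"
      by simp_all
    obtain g' where g': "descends g g'"
      using ex_descends by blast
    note occ' = less.prems[THEN descends_occ[OF g']]
    have yx: "occ g [y, x]"
      by (rule occ_sublist[OF less.prems(2)]) (simp add: sublist_code)
    have "occ g [y, x, y]"
      by (rule occ_sublist[OF less.prems(2)]) (simp add: sublist_code)
    then have yx_dvd: "5 dvd length (concat (map g [y, x]))"
      using occ_two_same[of g y "[x]"] ne by simp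
    have yz: "occ g [y, z]"
      by (rule occ_sublist[OF less.prems(1)]) (simp add: sublist_code)
    have "occ g [y, z, y]"
      by (rule occ_sublist[OF less.prems(1)]) (simp add: sublist_code)
    then have yz_dvd: "5 dvd length (concat (map g [y, z]))"
      using occ_two_same[of g y "[z]"] ne by simp
    note nonempty = descends_nonempty[OF g' yx yx_dvd _ ne(1)] descends_nonempty[OF g' yz yz_dvd _ ne(3)]
    have l: "length (g y) + length (g x) = 5 * (length (g' y) + length (g' x))"
      "length (g y) + length (g z) = 5 * (length (g' y) + length (g' z))"
      using descends_length[OF g' yx yx_dvd] descends_length[OF g' yz yz_dvd] by simp_all
    then have "length (g' x) + length (g' y) + length (g' z) < length (g x) + length (g y) + length (g z)"
      using ne by (auto simp flip: length_greater_0_conv)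
    from less.hyps[OF this occ'] consider "g' y = []" | "g' y \<noteq> []" "g' x = []" | "g' y \<noteq> []" "g' z = []"
      by blast
    then show False
    proof cases
      case 1
      then have "g' x = [] \<or> g' z = []"
        using occ' by (intro occ_xyx_yxy[of g' x z]) (simp_all add: occ_def)
      with 1 nonempty show False
        by simp
    next
      case 2
      then have "occ g' [y, y]"
        using occ_sublist[OF occ'(2), of "[y, x, y]"] by (simp add: occ_def sublist_code)
      with 2 occ_xx show False
        by blast
    next
      case 3
      then have "occ g' [y, y]"
        using occ_sublist[OF occ'(1), of "[y, z, y]"] by (simp add: occ_def sublist_code)
      with 3 occ_xx show False
        by blast
    qed
  qed
qed

text \<open>The length of \<open>xyz\<close> is a multiple of 5. If one variable vanishes, the other
  two form the words of \<open>occ_xyx_yxy\<close>; so a second one vanishes, and the third is left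
  in a square.\<close>

lemma occ_xyzx_yzxy_zxyz:
  fixes g :: "var3 \<Rightarrow> nat list"
  assumes "occ g [x, y, z, x]" "occ g [y, z, x, y]" "occ g [z, x, y, z]"
  shows "g x = [] \<or> g y = [] \<or> g z = []"
  using assms
proof (induction "length (g x) + length (g y) + length (g z)" arbitrary: g rule: less_induct)
  case less
  show ?case
  proof (rule ccontr)
    assume "\<not> (g x = [] \<or> g y = [] \<or> g z = [])"
    then have ne: "g x \<noteq> []" "g y \<noteq> []" "g z \<noteq> []"
      by simp_all
    obtain g' where g': "descends g g'"
      using ex_descends by blast
    note occ' = less.prems[THEN descends_occ[OF g']]
    have xyz: "occ g [x, y, z]"
      by (rule occ_sublist[OF less.prems(1)]) (simp add: sublist_code)
    have "occ g [x, y, z, x]"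
      by (rule occ_sublist[OF less.prems(1)]) (simp add: sublist_code)
    then have xyz_dvd: "5 dvd length (concat (map g [x, y, z]))"
      using occ_two_same[of g x "[y, z]"] ne by simp
    note nonempty = descends_nonempty[OF g' xyz xyz_dvd _ ne(1)]
    have l: "length (g x) + length (g y) + length (g z) = 5 * (length (g' x) + length (g' y) + length (g' z))"
      using descends_length[OF g' xyz xyz_dvd] by simp
    then have "length (g' x) + length (g' y) + length (g' z) < length (g x) + length (g y) + length (g z)"
      using ne by (auto simp flip: length_greater_0_conv)
    from less.hyps[OF this occ'] consider "g' x = []" | "g' y = []" | "g' z = []"
      by blast
    then show False
    proof cases
      case 1
      have "g' y = [] \<or> g' z = []"
        using occ' 1 by (intro occ_xyx_yxy[of g' y z]) (simp_all add: occ_def)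
      moreover have "g' z = []" if "g' y = []"
        using occ'(3) 1 that by (intro occ_xx[of g' z]) (simp add: occ_def)
      moreover have "g' y = []" if "g' z = []"
        using occ'(2) 1 that by (intro occ_xx[of g' y]) (simp add: occ_def)
      ultimately have "g' y = [] \<and> g' z = []"
        by blast
      with 1 nonempty show False
        by simp
    next
      case 2
      have "g' x = [] \<or> g' z = []"
        using occ' 2 by (intro occ_xyx_yxy[of g' x z]) (simp_all add: occ_def)
      moreover have "g' z = []" if "g' x = []"
        using occ'(3) 2 that by (intro occ_xx[of g' z]) (simp add: occ_def)
      moreover have "g' x = []" if "g' z = []"
        using occ'(1) 2 that by (intro occ_xx[of g' x]) (simp add: occ_def)
      ultimately have "g' x = [] \<and> g' z = []"
        by blast
      with 2 nonempty show False
        by simp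
    next
      case 3
      have "g' x = [] \<or> g' y = []"
        using occ' 3 by (intro occ_xyx_yxy[of g' x y]) (simp_all add: occ_def)
      moreover have "g' y = []" if "g' x = []"
        using occ'(2) 3 that by (intro occ_xx[of g' y]) (simp add: occ_def)
      moreover have "g' x = []" if "g' y = []"
        using occ'(1) 3 that by (intro occ_xx[of g' x]) (simp add: occ_def)
      ultimately have "g' x = [] \<and> g' y = []"
        by blast
      with 3 nonempty show False
        by simp
    qed
  qed
qed

text \<open>The lengths of \<open>xyz\<close> and, through \<open>zyz\<close>, of \<open>zy\<close>
  are multiples of 5. Hence so is that of \<open>x\<close> alone, which therefore survives
  desubstitution.\<close>

lemma occ_xyzx_yzxy_zyz:
  fixes g :: "var3 \<Rightarrow> nat list"
  assumes "occ g [x, y, z, x]" "occ g [y, z, x, y]" "occ g [z, y, z]"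
  shows "g x = [] \<or> g y = [] \<or> g z = []"
  using assms
proof (induction "length (g x) + length (g y) + length (g z)" arbitrary: g rule: less_induct)
  case less
  show ?case
  proof (rule ccontr)
    assume "\<not> (g x = [] \<or> g y = [] \<or> g z = [])"
    then have ne: "g x \<noteq> []" "g y \<noteq> []" "g z \<noteq> []"
      by simp_all
    obtain g' where g': "descends g g'"
      using ex_descends by blast
    note occ' = less.prems[THEN descends_occ[OF g']]
    have xyz: "occ g [x, y, z]"
      by (rule occ_sublist[OF less.prems(1)]) (simp add: sublist_code)
    have "occ g [x, y, z, x]"
      by (rule occ_sublist[OF less.prems(1)]) (simp add: sublist_code)
    then have xyz_dvd: "5 dvd length (concat (map g [x, y, z]))"
      using occ_two_same[of g x "[y, z]"] ne by simp
    have "occ g [z, y, z]"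
      by (rule occ_sublist[OF less.prems(3)]) (simp add: sublist_code)
    then have zy_dvd: "5 dvd length (concat (map g [z, y]))"
      using occ_two_same[of g z "[y]"] ne by simp
    have "5 dvd length (g x) + (length (g y) + length (g z))" "5 dvd length (g y) + length (g z)"
      using xyz_dvd zy_dvd by (simp_all add: ac_simps)
    then have "5 dvd length (g x)"
      using dvd_add_left_iff by blast
    then have x_dvd: "5 dvd length (concat (map g [x]))"
      by simp
    have x: "occ g [x]"
      by (rule occ_sublist[OF less.prems(1)]) (simp add: sublist_code)
    have x': "g' x \<noteq> []"
      using descends_nonempty[OF g' x x_dvd _ ne(1)] by simp
    have "length (g x) + length (g y) + length (g z) = 5 * (length (g' x) + length (g' y) + length (g' z))"
      using descends_length[OF g' xyz xyz_dvd] by simp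
    then have "length (g' x) + length (g' y) + length (g' z) < length (g x) + length (g y) + length (g z)"
      using ne by (auto simp flip: length_greater_0_conv)
    from less.hyps[OF this occ'] x' consider "g' y = []" | "g' z = []"
      by blast
    then show False
    proof cases
      case 1
      then have "g' z = []"
        using occ'(3) by (intro occ_xx[of g' z]) (simp add: occ_def)
      then have "g' x = []"
        using occ'(1) 1 by (intro occ_xx[of g' x]) (simp add: occ_def)
      with x' show False ..
    next
      case 2
      then have "g' x = [] \<or> g' y = []"
        using occ' by (intro occ_xyx_yxy[of g' x y]) (simp_all add: occ_def)
      moreover have "g' x = []" if "g' y = []"
        using occ'(1) 2 that by (intro occ_xx[of g' x]) (simp add: occ_def)
      ultimately show False
        using x' by blast
    qed
  qed
qed

lemma occ_xzyx_yxzy_zyz: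
  fixes g :: "var3 \<Rightarrow> nat list"
  assumes "occ g [x, z, y, x]" "occ g [y, x, z, y]" "occ g [z, y, z]"
  shows "g x = [] \<or> g y = [] \<or> g z = []"
  using assms
proof (induction "length (g x) + length (g y) + length (g z)" arbitrary: g rule: less_induct)
  case less
  show ?case
  proof (rule ccontr)
    assume "\<not> (g x = [] \<or> g y = [] \<or> g z = [])"
    then have ne: "g x \<noteq> []" "g y \<noteq> []" "g z \<noteq> []"
      by simp_all
    obtain g' where g': "descends g g'"
      using ex_descends by blast
    note occ' = less.prems[THEN descends_occ[OF g']]
    have xzy: "occ g [x, z, y]"
      by (rule occ_sublist[OF less.prems(1)]) (simp add: sublist_code)
    have "occ g [x, z, y, x]"
      by (rule occ_sublist[OF less.prems(1)]) (simp add: sublist_code)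
    then have xzy_dvd: "5 dvd length (concat (map g [x, z, y]))"
      using occ_two_same[of g x "[z, y]"] ne by simp
    have "occ g [z, y, z]"
      by (rule occ_sublist[OF less.prems(3)]) (simp add: sublist_code)
    then have zy_dvd: "5 dvd length (concat (map g [z, y]))"
      using occ_two_same[of g z "[y]"] ne by simp
    have "5 dvd length (g x) + (length (g y) + length (g z))" "5 dvd length (g y) + length (g z)"
      using xzy_dvd zy_dvd by (simp_all add: ac_simps)
    then have "5 dvd length (g x)"
      using dvd_add_left_iff by blast
    then have x_dvd: "5 dvd length (concat (map g [x]))"
      by simp
    have x: "occ g [x]"
      by (rule occ_sublist[OF less.prems(1)]) (simp add: sublist_code)
    have x': "g' x \<noteq> []"
      using descends_nonempty[OF g' x x_dvd _ ne(1)] by simp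
    have "length (g x) + length (g y) + length (g z) = 5 * (length (g' x) + length (g' y) + length (g' z))"
      using descends_length[OF g' xzy xzy_dvd] by simp
    then have "length (g' x) + length (g' y) + length (g' z) < length (g x) + length (g y) + length (g z)"
      using ne by (auto simp flip: length_greater_0_conv)
    from less.hyps[OF this occ'] x' consider "g' y = []" | "g' z = []"
      by blast
    then show False
    proof cases
      case 1
      then have "g' z = []"
        using occ'(3) by (intro occ_xx[of g' z]) (simp add: occ_def)
      then have "g' x = []"
        using occ'(1) 1 by (intro occ_xx[of g' x]) (simp add: occ_def)
      with x' show False ..
    next
      case 2
      then have "g' x = [] \<or> g' y = []"
        using occ' by (intro occ_xyx_yxy[of g' x y]) (simp_all add: occ_def)
      moreover have "g' x = []" if "g' y = []"
        using occ'(1) 2 that by (intro occ_xx[of g' x]) (simp add: occ_def)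
      ultimately show False
        using x' by blast
    qed
  qed
qed

text \<open>Both \<open>y\<close> and \<open>z\<close> follow \<open>x\<close>, and both
  \<open>x\<close> and \<open>y\<close> follow \<open>z\<close>, so all three start in the same
  residue class. Then each length is a multiple of 5 and no variable can vanish.\<close>

lemma occ_xy_xz_yx_zx_zy:
  fixes g :: "var3 \<Rightarrow> nat list"
  assumes "occ g [x, y]" "occ g [x, z]" "occ g [y, x]" "occ g [z, x]" "occ g [z, y]"
  shows "g x = [] \<or> g y = [] \<or> g z = []"
  using assms
proof (induction "length (g x) + length (g y) + length (g z)" arbitrary: g rule: less_induct)
  case less
  show ?case
  proof (rule ccontr)
    assume "\<not> (g x = [] \<or> g y = [] \<or> g z = [])"
    then have ne: "g x \<noteq> []" "g y \<noteq> []" "g z \<noteq> []"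
      by simp_all
    obtain g' where g': "descends g g'"
      using ex_descends by blast
    note occ' = less.prems[THEN descends_occ[OF g']]
    have e: "entry g y = (entry g x + length (g x)) mod 5" "entry g z = (entry g x + length (g x)) mod 5"
      "entry g x = (entry g y + length (g y)) mod 5" "entry g x = (entry g z + length (g z)) mod 5"
      "entry g y = (entry g z + length (g z)) mod 5"
      using less.prems[THEN entry_step] ne by blast+
    note z = trans[OF e(2) e(1)[symmetric]] and x = trans[OF e(4) e(5)[symmetric]]
    have "entry g x = (entry g x + length (g x)) mod 5" "entry g y = (entry g y + length (g y)) mod 5"
      "entry g z = (entry g z + length (g z)) mod 5"
      by (rule trans[OF x e(1)], rule trans[OF x[symmetric] e(3)],
          rule trans[OF trans[OF z x[symmetric]] e(4)])
    from this[THEN dvd_if_mod_fixed]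
    have dvd: "5 dvd length (concat (map g [x]))" "5 dvd length (concat (map g [y]))"
      "5 dvd length (concat (map g [z]))"
      by simp_all
    have single: "occ g [x]" "occ g [y]" "occ g [z]"
      using less.prems(1)[THEN occ_sublist, of "[x]"] less.prems(1)[THEN occ_sublist, of "[y]"]
        less.prems(2)[THEN occ_sublist, of "[z]"] by (simp_all add: sublist_code)
    have l: "length (g x) = 5 * length (g' x)" "length (g y) = 5 * length (g' y)"
      "length (g z) = 5 * length (g' z)"
      using descends_length[OF g' single(1) dvd(1)] descends_length[OF g' single(2) dvd(2)]
        descends_length[OF g' single(3) dvd(3)] by simp_all
    then have ne': "g' x \<noteq> []" "g' y \<noteq> []" "g' z \<noteq> []"
      using ne by auto
    then have "length (g' x) + length (g' y) + length (g' z) < length (g x) + length (g y) + length (g z)"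
      using l by (auto simp flip: length_greater_0_conv)
    from less.hyps[OF this occ'] ne' show False
      by blast
  qed
qed

section \<open>Avoidability of the formulas of the basis\<close>

text \<open>Residues of positions increase by one along the word, so adjacent letters occurring in
  both orders would give \<open>r + 2 = r\<close> modulo 5.\<close>

lemma fac_rev_imp_short:
  assumes "fac u" "fac (rev u)"
  shows "length u \<le> 1"
proof (rule ccontr)
  assume l: "\<not> length u \<le> 1"
  then obtain a b w where u: "u = a # b # w"
    by (metis One_nat_def Suc_le_length_iff not_less_eq_eq)
  have "fac [a, b]" "fac [b, a]"
    using fac_sublist[OF assms(1), of "[a, b]"] fac_sublist[OF assms(2), of "[b, a]"]
    by (auto simp: u sublist_code sublist_append)
  then obtain i j where ij: "[a, b] = seg i (length [a, b])" "[b, a] = seg j (length [b, a])"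
    unfolding fac_def by blast
  have "seg k (length [c, d]) = [omega k, omega (Suc k)]" for k c d
    by (simp add: seg_def)
  with ij have "[a, b] = [omega i, omega (Suc i)]" "[b, a] = [omega j, omega (Suc j)]"
    by metis+
  then have "omega i = omega (Suc j)" "omega j = omega (Suc i)"
    by (metis list.inject)+
  from this[THEN arg_cong[where f = "\<lambda>k. k mod 5"]]
  have "i mod 5 = Suc j mod 5" "j mod 5 = Suc i mod 5"
    unfolding omega_mod .
  moreover have "\<not> (a = (if Suc b = 5 then 0 else Suc b) \<and> b = (if Suc a = 5 then 0 else Suc a))"
    for a b :: nat
    by auto
  ultimately show False
    unfolding mod_Suc by blast
qed

text \<open>By \<open>both\<close> a reversed variable also occurs plain, so its image and the
  mirror image are factors and it is a single letter. The marks can then be dropped, and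
  \<open>contra\<close> applies. The prefixes of the word are infinitely many witnesses.\<close>

lemma avoidableI:
  fixes \<phi> :: "'v formula"
  assumes both: "\<forall>p\<in>\<phi>. \<forall>l\<in>set p. \<exists>q\<in>\<phi>. Var (base l) \<in> set q"
    and contra: "\<And>g :: 'v \<Rightarrow> nat list. \<forall>v. g v \<noteq> [] \<Longrightarrow> \<forall>p\<in>\<phi>. occ g (map base p) \<Longrightarrow>
      \<forall>p\<in>\<phi>. \<forall>l\<in>set p. l = Rev (base l) \<longrightarrow> length (g (base l)) = 1 \<Longrightarrow> False"
  shows "avoidable \<phi>"
proof -
  have "avoids {..<25} (seg 0 n) \<phi>" for n
    unfolding avoids_def occurs_in_def
  proof (intro notI, elim exE conjE)
    fix f :: "'v pattern \<Rightarrow> nat list"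
    assume f: "word_morphism f" "non_erasing f" "respects_reversal f"
      and sub: "\<forall>p\<in>\<phi>. sublist (f p) (seg 0 n)"
    have "fac (seg 0 n)"
      unfolding fac_def by (metis length_seg)
    with sub have fac: "fac (f p)" if "p \<in> \<phi>" for p
      using that fac_sublist by blast
    define g where "g v = f [Var v]" for v
    have rev: "f [Rev v] = rev (g v)" for v
      using f(3) by (simp add: respects_reversal_def g_def)
    have ne: "\<forall>v. g v \<noteq> []"
      using f(2) by (simp add: non_erasing_def g_def)
    have fac_letter: "fac (f [l])" if "p \<in> \<phi>" "l \<in> set p" for p l
    proof -
      obtain p1 p2 where "p = p1 @ l # p2"
        using split_list[OF \<open>l \<in> set p\<close>] by blast
      then have "f p = concat (map (\<lambda>l. f [l]) p1) @ f [l] @ concat (map (\<lambda>l. f [l]) p2)"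
        by (subst morphism_letters[OF f(1)]) simp
      then show ?thesis
        using fac[OF \<open>p \<in> \<phi>\<close>] fac_sublist sublist_appendI by metis
    qed
    have short: "length (g v) = 1" if "p \<in> \<phi>" "Rev v \<in> set p" for p v
    proof -
      have "fac (g v)" "fac (rev (g v))"
        using bspec[OF bspec[OF both that(1)] that(2)] fac_letter[OF that] fac_letter[of _ "Var v"]
        by (auto simp: rev g_def)
      then have "length (g v) \<le> 1"
        by (rule fac_rev_imp_short)
      with ne show ?thesis
        by (metis One_nat_def Suc_leI length_greater_0_conv order_antisym)
    qed
    have "occ g (map base p)" if "p \<in> \<phi>" for p
    proof -
      have "f [l] = g (base l)" if "l \<in> set p" for l
      proof (cases l)
        case (Rev v)
        then have "length (g v) = 1"
          using short \<open>p \<in> \<phi>\<close> that by blast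
        then show ?thesis
          by (auto simp: Rev rev length_Suc_conv)
      qed (simp add: g_def)
      then have "f p = concat (map g (map base p))"
        by (subst morphism_letters[OF f(1)]) (auto intro!: arg_cong[where f = concat])
      then show ?thesis
        using fac[OF that] by (simp add: occ_def)
    qed
    moreover have "length (g (base l)) = 1" if "p \<in> \<phi>" "l \<in> set p" "l = Rev (base l)" for p l
      using short[of p "base l"] that by metis
    ultimately show False
      using contra[of g] ne by blast
  qed
  moreover have "seg 0 n \<in> lists {..<25}" for n
    by (auto simp: seg_def omega_less)
  ultimately have "range (seg 0) \<subseteq> {w \<in> lists {..<25}. avoids {..<25} w \<phi>}"
    by blast
  moreover have "inj (seg 0)"
    by (rule injI) (metis length_seg)
  then have "infinite (range (seg 0))"
    using finite_imageD by blast
  ultimately have "k_avoidable 25 \<phi>"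
    unfolding k_avoidable_def using finite_subset by blast
  then show ?thesis
    unfolding avoidable_def by blast
qed

lemma Phi3_avoidable: "\<forall>\<phi>\<in>Phi3. avoidable \<phi>"
  unfolding Phi3_def Let_def ball_Un ball_insert_distrib
  \<comment> \<open>\<open>One_nat_def\<close> is withheld so that lengths keep the form
    \<open>length _ = 1\<close> of the lemmas on short images.\<close>
  by (intro conjI ballI; (elim emptyE)?; rule avoidableI; simp del: One_nat_def;
      (meson occ_xx occ_xyx_yxy occ_xyzyx_zyxyz occ_xyzx_yzxy_zxyz occ_xyzx_yzxy_zyz
        occ_xzyx_yxzy_zyz occ_xy_xz_yx_zx_zy occ_xyx_short occ_xyzx_short occ_xyzx_yzxy_short
        occ_xy_yx_short occ_xy_xz_yz_short occ_xy_yz_zx_short)?)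

section \<open>Formulas divided by no formula of the basis\<close>

text \<open>All letterwise maps behind e-division have this form, with \<open>a\<close>,
  \<open>b\<close>, \<open>c\<close> plain or reversed letters over distinct variables.\<close>

primrec inst :: "var3 letter \<Rightarrow> var3 letter \<Rightarrow> var3 letter \<Rightarrow> var3 letter \<Rightarrow> var3 letter" where
  "inst a b c (Var v) = (case v of X \<Rightarrow> a | Y \<Rightarrow> b | Z \<Rightarrow> c)"
| "inst a b c (Rev v) = bar (case v of X \<Rightarrow> a | Y \<Rightarrow> b | Z \<Rightarrow> c)"

lemma e_dividesI:
  assumes "distinct [base a, base b, base c]"
    and "\<And>p. p \<in> \<phi> \<Longrightarrow> factor_of_formula (map (inst a b c) p) \<psi>"
  shows "e_divides \<phi> \<psi>"
proof -
  have "l = m" if "inst a b c l = inst a b c m" for l m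
  proof -
    have *: "base (inst a b c l) = (case base l of X \<Rightarrow> base a | Y \<Rightarrow> base b | Z \<Rightarrow> base c)" for l
      by (cases l) (simp_all split: var3.split)
    have "base l = base m"
      using arg_cong[OF that, of base] assms(1) unfolding * by (auto split: var3.splits)
    moreover have "m \<noteq> bar l"
    proof
      assume "m = bar l"
      then have "inst a b c m = bar (inst a b c l)"
        by (cases l) simp_all
      with that show False
        by simp
    qed
    ultimately show ?thesis
      by (metis base_eq_iff)
  qed
  then have "inj (map (inst a b c))"
    by (simp add: inj_def)
  then show ?thesis
    unfolding e_divides_def using assms(2)
    by (intro exI[of _ "map (inst a b c)"])
      (auto simp: word_morphism_def respects_d_reversal_def)
qed

locale indivisible =
  fixes \<psi> :: "var3 formula"
  assumes indivisible: "\<And>\<phi>. \<phi> \<in> Phi3 \<Longrightarrow> \<not> e_divides \<phi> \<psi>"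
begin

abbreviation F :: "var3 pattern \<Rightarrow> bool" where
  "F p \<equiv> factor_of_formula p \<psi>"

lemma F_sublist: "F p \<Longrightarrow> sublist q p \<Longrightarrow> F q"
  unfolding factor_of_formula_def by (meson sublist_order.order_trans)

lemma forbidden_all:
  assumes "distinct [base a, base b, base c]"
  shows "\<forall>\<phi>\<in>Phi3. \<not> (\<forall>p\<in>\<phi>. F (map (inst a b c) p))"
  using indivisible e_dividesI[OF assms] by blast

text \<open>The members of \<open>Phi3\<close> in the order of its definition, for letters of either
  orientation, so that case distinctions on marks can instantiate them freely.\<close>

lemma forbidden:
  assumes "distinct [base a, base b, base c]"
  shows "\<not> F [a, a]" "\<not> F [a, bar a]"
    "\<not> (F [a, b, a] \<and> F [b, a, b])"
    "\<not> (F [a, b] \<and> F [b, a] \<and> F [bar a] \<and> F [bar b])"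
    "\<not> (F [a, b] \<and> F [b, bar a] \<and> F [bar b])"
    "\<not> (F [a, b] \<and> F [bar b, bar a])"
    "\<not> (F [a, b, a] \<and> F [bar b])"
    "\<not> (F [a, b] \<and> F [a, c] \<and> F [bar b, c])"
    "\<not> (F [a, bar b] \<and> F [b, bar c] \<and> F [c, bar a])"
    "\<not> (F [a, b, c, b, a] \<and> F [c, b, a, b, c])"
    "\<not> (F [a, b, c, b, a] \<and> F [c, b, a, bar b, c])"
    "\<not> (F [a, b, c, b, a] \<and> F [c, bar b, a, b, c])"
    "\<not> (F [a, b, c, b, a] \<and> F [c, bar b, a, bar b, c])"
    "\<not> (F [a, b, c, bar b, a] \<and> F [c, b, a, bar b, c])"
    "\<not> (F [a, b, c, bar b, a] \<and> F [c, bar b, a, b, c])"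
    "\<not> (F [a, b] \<and> F [a, c] \<and> F [b, c] \<and> F [bar b])"
    "\<not> (F [a, b] \<and> F [a, c] \<and> F [bar b, bar c])"
    "\<not> (F [b, a] \<and> F [c, a] \<and> F [bar c, bar b])"
    "\<not> (F [a, b] \<and> F [a, c] \<and> F [b, bar c] \<and> F [bar b])"
    "\<not> (F [b, a] \<and> F [c, a] \<and> F [bar c, b] \<and> F [bar b])"
    "\<not> (F [a, b] \<and> F [bar a, bar c] \<and> F [b, c] \<and> F [bar b])"
    "\<not> (F [a, b] \<and> F [bar a, bar c] \<and> F [bar b, c])"
    "\<not> (F [a, b, c, a] \<and> F [b, c, a, b] \<and> F [c, a, b, c])"
    "\<not> (F [a, b, c, a] \<and> F [b, c, a, b] \<and> F [c, b, c])"
    "\<not> (F [a, c, b, a] \<and> F [b, a, c, b] \<and> F [c, b, c])"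
    "\<not> (F [a, b, c, a] \<and> F [b, c, a, b] \<and> F [bar c])"
    "\<not> (F [a, b, c, a] \<and> F [b, bar c, a, b])"
    "\<not> (F [a, b] \<and> F [a, c] \<and> F [b, a] \<and> F [c, a] \<and> F [c, b])"
    "\<not> (F [a, b] \<and> F [b, c] \<and> F [c, a] \<and> F [bar a] \<and> F [bar b] \<and> F [bar c])"
    "\<not> (F [a, b] \<and> F [b, c] \<and> F [c, bar a] \<and> F [bar b] \<and> F [bar c])"
    "\<not> (F [a, b] \<and> F [b, c] \<and> F [bar c, bar a] \<and> F [bar b])"
    "\<not> (F [a, b, c, a] \<and> F [bar b] \<and> F [bar c])"
  by (simp_all only: simp_thms forbidden_all[OF assms, unfolded Phi3_def Let_def ball_Un
      ball_insert_distrib ball_empty simp_thms list.map inst.simps var3.case bar_bar])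

definition occurs_flat :: "var3 list \<Rightarrow> bool" where
  "occurs_flat q \<longleftrightarrow> (\<exists>p. F p \<and> map base p = q)"

definition two_way :: "var3 \<Rightarrow> bool" where
  "two_way v \<longleftrightarrow> F [Var v] \<and> F [Rev v]"

lemma two_way_iff: "two_way (base l) \<longleftrightarrow> F [l] \<and> F [bar l]"
  by (cases l) (auto simp: two_way_def)

lemma F_letter: "F p \<Longrightarrow> l \<in> set p \<Longrightarrow> F [l]"
  by (rule F_sublist, assumption) (auto simp: sublist_def dest: split_list)

lemma two_way_F: "two_way (base l) \<Longrightarrow> F [l] \<and> F [bar l]"
  by (simp add: two_way_iff)

text \<open>For a one-way variable that occurs, this is its only form; for all others it is an
  arbitrary choice.\<close>

definition orient :: "var3 \<Rightarrow> var3 letter" where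
  "orient v = (if F [Var v] then Var v else Rev v)"

lemma base_orient [simp]: "base (orient v) = v"
  by (simp add: orient_def)

lemma one_way_letter: "F p \<Longrightarrow> l \<in> set p \<Longrightarrow> \<not> two_way (base l) \<Longrightarrow> l = orient (base l)"
  using F_letter[of p l] by (cases l) (auto simp: two_way_def orient_def)

lemma one_way_unique:
  assumes "\<not> two_way v" "F p" "F q" "l \<in> set p" "m \<in> set q" "base l = v" "base m = v"
  shows "m = l"
  using one_way_letter[OF assms(2,4)] one_way_letter[OF assms(3,5)] assms(1,6,7) by metis

lemma one_way_lift:
  assumes "occurs_flat q" "\<forall>v\<in>set q. \<not> two_way v"
  shows "F (map orient q)"
proof -
  obtain p where p: "F p" "map base p = q"
    using assms(1) by (auto simp: occurs_flat_def)
  then have "map (orient \<circ> base) p = p"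
    using assms(2) one_way_letter[OF p(1)] by (intro map_idI) auto
  with p show ?thesis
    by auto
qed

lemma flat2E:
  assumes "occurs_flat [x, y]"
  obtains a b where "F [a, b]" "base a = x" "base b = y"
  using assms unfolding occurs_flat_def by (auto simp: map_eq_Cons_conv)

lemma flat3E:
  assumes "occurs_flat [x, y, z]"
  obtains a b c where "F [a, b, c]" "base a = x" "base b = y" "base c = z"
  using assms unfolding occurs_flat_def by (auto simp: map_eq_Cons_conv)

lemma flat4E:
  assumes "occurs_flat [x, y, z, u]"
  obtains a b c d where "F [a, b, c, d]" "base a = x" "base b = y" "base c = z" "base d = u"
  using assms unfolding occurs_flat_def by (auto simp: map_eq_Cons_conv)

lemma flat5E:
  assumes "occurs_flat [x, y, z, u, v]"
  obtains a b c d e where "F [a, b, c, d, e]" "base a = x" "base b = y" "base c = z" "base d = u" "base e = v"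
  using assms unfolding occurs_flat_def by (auto simp: map_eq_Cons_conv)

section \<open>Plain formulas missing from an indivisible formula\<close>

context
  fixes x y z :: var3
  assumes distinct: "distinct [x, y, z]"
begin

lemma no_xx: "\<not> occurs_flat [x, x]"
proof
  assume "occurs_flat [x, x]"
  then obtain a b where ab: "F [a, b]" "base a = x" "base b = x"
    by (rule flat2E)
  then have "b = a \<or> b = bar a"
    by (simp flip: base_eq_iff)
  with ab(1,2) forbidden(1,2)[of a "Var y" "Var z"] distinct show False
    by auto
qed

lemma no_xyx_yxy:
  assumes "\<not> two_way x" "\<not> two_way y"
  shows "\<not> (occurs_flat [x, y, x] \<and> occurs_flat [y, x, y])"
  using assms distinct forbidden(3)[of "orient x" "orient y" "orient z"]
    one_way_lift[of "[x, y, x]"] one_way_lift[of "[y, x, y]"]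
  by auto

lemma no_xyzx_yzxy_zxyz:
  assumes "\<not> two_way x" "\<not> two_way y" "\<not> two_way z"
  shows "\<not> (occurs_flat [x, y, z, x] \<and> occurs_flat [y, z, x, y] \<and> occurs_flat [z, x, y, z])"
  using assms distinct forbidden(23)[of "orient x" "orient y" "orient z"]
    one_way_lift[of "[x, y, z, x]"] one_way_lift[of "[y, z, x, y]"] one_way_lift[of "[z, x, y, z]"]
  by auto

lemma no_xyzx_yzxy_zyz:
  assumes "\<not> two_way x" "\<not> two_way y" "\<not> two_way z"
  shows "\<not> (occurs_flat [x, y, z, x] \<and> occurs_flat [y, z, x, y] \<and> occurs_flat [z, y, z])"
  using assms distinct forbidden(24)[of "orient x" "orient y" "orient z"]
    one_way_lift[of "[x, y, z, x]"] one_way_lift[of "[y, z, x, y]"] one_way_lift[of "[z, y, z]"]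
  by auto

lemma no_xzyx_yxzy_zyz:
  assumes "\<not> two_way x" "\<not> two_way y" "\<not> two_way z"
  shows "\<not> (occurs_flat [x, z, y, x] \<and> occurs_flat [y, x, z, y] \<and> occurs_flat [z, y, z])"
  using assms distinct forbidden(25)[of "orient x" "orient y" "orient z"]
    one_way_lift[of "[x, z, y, x]"] one_way_lift[of "[y, x, z, y]"] one_way_lift[of "[z, y, z]"]
  by auto

lemma no_xy_xz_yx_zx_zy:
  assumes "\<not> two_way x" "\<not> two_way y" "\<not> two_way z"
  shows "\<not> (occurs_flat [x, y] \<and> occurs_flat [x, z] \<and> occurs_flat [y, x] \<and> occurs_flat [z, x] \<and> occurs_flat [z, y])"
  using assms distinct forbidden(28)[of "orient x" "orient y" "orient z"]
    one_way_lift[of "[x, y]"] one_way_lift[of "[x, z]"] one_way_lift[of "[y, x]"] one_way_lift[of "[z, x]"] one_way_lift[of "[z, y]"]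
  by auto

text \<open>Relative to the letters \<open>a\<close>, \<open>b\<close> of the first word, the second
  allows four choices of marks. Each is forbidden, the fragments of length one being available
  because both variables are two-way.\<close>

lemma no_xy_yx:
  assumes "two_way x" "two_way y"
  shows "\<not> (occurs_flat [x, y] \<and> occurs_flat [y, x])"
proof (intro notI, elim conjE)
  assume "occurs_flat [x, y]" "occurs_flat [y, x]"
  then obtain a b a' b' where ab: "F [a, b]" "base a = x" "base b = y"
    "F [b', a']" "base b' = y" "base a' = x"
    by (elim flat2E)
  have two: "F [a]" "F [bar a]" "F [b]" "F [bar b]"
    using two_way_F[of a] two_way_F[of b] assms ab by auto
  have "a' = a \<or> a' = bar a" "b' = b \<or> b' = bar b"
    using ab by (simp_all flip: base_eq_iff)
  then show False
    using ab two forbidden(4,5,6)[of a b "Var z"] forbidden(5)[of "bar b" a "Var z"] distinct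
    by auto
qed

lemma no_xyx:
  assumes "\<not> two_way x" "two_way y"
  shows "\<not> occurs_flat [x, y, x]"
proof
  assume "occurs_flat [x, y, x]"
  then obtain a b a' where ab: "F [a, b, a']" "base a = x" "base b = y" "base a' = x"
    by (elim flat3E)
  have "a' = a"
    by (rule one_way_unique[OF assms(1) ab(1) ab(1)]) (simp_all add: ab)
  moreover have "F [bar b]"
    using assms ab two_way_F[of b] by auto
  ultimately show False
    using ab forbidden(7)[of a b "Var z"] distinct by simp
qed

text \<open>All eight choices of marks are forbidden, some of them after replacing \<open>c\<close>
  by \<open>bar c\<close> or letting \<open>c\<close> and \<open>bar a\<close> exchange the roles of
  \<open>x\<close> and \<open>z\<close>.\<close>

lemma no_xy_xz_yz:
  assumes "two_way y"
  shows "\<not> (occurs_flat [x, y] \<and> occurs_flat [x, z] \<and> occurs_flat [y, z])"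
proof (intro notI, elim conjE)
  assume "occurs_flat [x, y]" "occurs_flat [x, z]" "occurs_flat [y, z]"
  then obtain a b c a' b' c' where ab: "F [a, b]" "base a = x" "base b = y"
    "F [a', c']" "base a' = x" "base c' = z" "F [b', c]" "base b' = y" "base c = z"
    by (elim flat2E)
  have two: "F [b]" "F [bar b]"
    using two_way_F[of b] assms ab by auto
  have eqs: "a' = a \<or> a' = bar a" "b' = b \<or> b' = bar b" "c' = c \<or> c' = bar c"
    using ab by (simp_all flip: base_eq_iff)
  have d: "distinct [base a, base b, base c]"
    using ab distinct by simp
  then have d': "distinct [base a, base b, base (bar c)]" "distinct [base c, base b, base (bar a)]"
    "distinct [base c, base (bar b), base (bar a)]"
    by auto
  note forb = forbidden(8,16,21,22)[OF d] forbidden(17,19)[OF d'(1)] forbidden(20)[OF d'(2)]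
    forbidden(18)[OF d'(3)]
  from eqs show False
    by (elim disjE) (use two ab(1,4,7) forb in simp_all)
qed

text \<open>All eight choices of marks are forbidden, up to cyclic rotation and change of
  orientation.\<close>

lemma no_xy_yz_zx:
  assumes "two_way x" "two_way y" "two_way z"
  shows "\<not> (occurs_flat [x, y] \<and> occurs_flat [y, z] \<and> occurs_flat [z, x])"
proof (intro notI, elim conjE)
  assume "occurs_flat [x, y]" "occurs_flat [y, z]" "occurs_flat [z, x]"
  then obtain a b c a' b' c' where ab: "F [a, b]" "base a = x" "base b = y"
    "F [b', c]" "base b' = y" "base c = z" "F [c', a']" "base c' = z" "base a' = x"
    by (elim flat2E)
  have two: "F [a]" "F [bar a]" "F [b]" "F [bar b]" "F [c]" "F [bar c]"
    using two_way_F[of a] two_way_F[of b] two_way_F[of c] assms ab by auto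
  have eqs: "a' = a \<or> a' = bar a" "b' = b \<or> b' = bar b" "c' = c \<or> c' = bar c"
    using ab by (simp_all flip: base_eq_iff)
  have d: "distinct [base a, base b, base c]"
    using ab distinct by simp
  then have d': "distinct [base (bar b), base c, base a]" "distinct [base (bar c), base a, base b]"
    "distinct [base (bar b), base c, base (bar a)]" "distinct [base a, base (bar b), base (bar c)]"
    by auto
  note forb = forbidden(29,30,31)[OF d] forbidden(30)[OF d'(1)] forbidden(30,31)[OF d'(2)]
    forbidden(31)[OF d'(3)] forbidden(9)[OF d'(4)]
  from eqs show False
    by (elim disjE) (use two ab(1,4,7) forb in simp_all)
qed

text \<open>The one-way letters are fixed, so only three marks on \<open>y\<close> are free. Six of
  the eight choices are members of the list as they stand, the other two after exchanging
  \<open>a\<close> and \<open>c\<close>.\<close>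

lemma no_xyzyx_zyxyz:
  assumes "\<not> two_way x" "\<not> two_way z"
  shows "\<not> (occurs_flat [x, y, z, y, x] \<and> occurs_flat [z, y, x, y, z])"
proof (intro notI, elim conjE)
  assume "occurs_flat [x, y, z, y, x]" "occurs_flat [z, y, x, y, z]"
  then obtain a b c b1 a1 c2 b2 a2 b3 c3 where
    1: "F [a, b, c, b1, a1]" "base a = x" "base b = y" "base c = z" "base b1 = y" "base a1 = x" and
    2: "F [c2, b2, a2, b3, c3]" "base c2 = z" "base b2 = y" "base a2 = x" "base b3 = y" "base c3 = z"
    by (elim flat5E)
  have ac: "a1 = a" "a2 = a" "c2 = c" "c3 = c"
    subgoal by (rule one_way_unique[OF assms(1) 1(1) 1(1)]) (simp_all add: 1)
    subgoal by (rule one_way_unique[OF assms(1) 1(1) 2(1)]) (simp_all add: 1 2)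
    subgoal by (rule one_way_unique[OF assms(2) 1(1) 2(1)]) (simp_all add: 1 2)
    subgoal by (rule one_way_unique[OF assms(2) 1(1) 2(1)]) (simp_all add: 1 2)
    done
  have eqs: "b1 = b \<or> b1 = bar b" "b2 = b \<or> b2 = bar b" "b3 = b \<or> b3 = bar b"
    using 1 2 by (simp_all flip: base_eq_iff)
  have d: "distinct [base a, base b, base c]"
    using 1 distinct by simp
  then have d': "distinct [base c, base b, base a]" "distinct [base c, base (bar b), base a]"
    by auto
  note forb = forbidden(10-15)[OF d] forbidden(11)[OF d'(1)] forbidden(12)[OF d'(2)]
  from eqs show False
    by (elim disjE) (use 1(1) 2(1) forb in \<open>simp_all add: ac\<close>)
qed

lemma no_xyzx_yzxy:
  assumes "\<not> two_way x" "\<not> two_way y" "two_way z"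
  shows "\<not> (occurs_flat [x, y, z, x] \<and> occurs_flat [y, z, x, y])"
proof (intro notI, elim conjE)
  assume "occurs_flat [x, y, z, x]" "occurs_flat [y, z, x, y]"
  then obtain a b c a1 b2 c2 a2 b3 where
    1: "F [a, b, c, a1]" "base a = x" "base b = y" "base c = z" "base a1 = x" and
    2: "F [b2, c2, a2, b3]" "base b2 = y" "base c2 = z" "base a2 = x" "base b3 = y"
    by (elim flat4E)
  have ab: "a1 = a" "a2 = a" "b2 = b" "b3 = b"
    subgoal by (rule one_way_unique[OF assms(1) 1(1) 1(1)]) (simp_all add: 1)
    subgoal by (rule one_way_unique[OF assms(1) 1(1) 2(1)]) (simp_all add: 1 2)
    subgoal by (rule one_way_unique[OF assms(2) 1(1) 2(1)]) (simp_all add: 1 2)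
    subgoal by (rule one_way_unique[OF assms(2) 1(1) 2(1)]) (simp_all add: 1 2)
    done
  have c: "F [bar c]" "c2 = c \<or> c2 = bar c"
    using 1 2 assms(3) two_way_F[of c] by (simp_all flip: base_eq_iff)
  have "distinct [base a, base b, base c]"
    using 1 distinct by simp
  note forb = forbidden(26,27)[OF this]
  from c(2) show False
    by (elim disjE) (use 1(1) 2(1) c(1) forb in \<open>simp_all add: ab\<close>)
qed

lemma no_xyzx:
  assumes "\<not> two_way x" "two_way y" "two_way z"
  shows "\<not> occurs_flat [x, y, z, x]"
proof
  assume "occurs_flat [x, y, z, x]"
  then obtain a b c a1 where
    1: "F [a, b, c, a1]" "base a = x" "base b = y" "base c = z" "base a1 = x"
    by (elim flat4E)
  have "a1 = a"
    by (rule one_way_unique[OF assms(1) 1(1) 1(1)]) (simp_all add: 1)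
  moreover have "F [bar b]" "F [bar c]"
    using 1 assms two_way_F[of b] two_way_F[of c] by simp_all
  moreover have "distinct [base a, base b, base c]"
    using 1 distinct by simp
  ultimately show False
    using 1(1) forbidden(32)[of a b c] by simp
qed

end

end

section \<open>The search for a substitution\<close>

definition good :: "'v list \<Rightarrow> ('v \<Rightarrow> 'v list) \<Rightarrow> 'v list \<Rightarrow> bool" where
  "good T s p \<longleftrightarrow> sublist (concat (map s p)) T"

lemma sublist_concat_map: "sublist p q \<Longrightarrow> sublist (concat (map s p)) (concat (map s q))"
  unfolding sublist_def by (metis concat_append map_append)

lemma good_sublist: "good T s q \<Longrightarrow> sublist p q \<Longrightarrow> good T s p"
  unfolding good_def by (rule sublist_order.order_trans[OF sublist_concat_map])

text \<open>
  \<open>bads T s n [[]]\<close> lists the minimal words that \<open>s\<close> does not map into \<open>T\<close>: a minimal bad word is a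
  good word with one letter put in front, and \<open>ws\<close> runs through the good words of each length.
\<close>

primrec bads :: "var3 list \<Rightarrow> (var3 \<Rightarrow> var3 list) \<Rightarrow> nat \<Rightarrow> var3 list list \<Rightarrow> var3 list list" where
  "bads T s 0 ws = []"
| "bads T s (Suc n) ws =
    (let us = concat (map (\<lambda>w. map (\<lambda>v. v # w) [X, Y, Z]) ws) in
     filter (\<lambda>u. \<not> good T s u \<and> good T s (butlast u)) us @ bads T s n (filter (good T s) us))"

text \<open>\<open>ws\<close> holds all good words of length \<open>k\<close>. The tail of a good
  word is good, so prefixing letters yields all good words of the next length.\<close>

lemma bads_complete_level:
  assumes "\<And>u. length u = k \<Longrightarrow> good T s u \<Longrightarrow> u \<in> set ws"
    and "\<not> good T s (v # u)" "good T s u" "good T s (butlast (v # u))" "k \<le> length u" "length u < k + n"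
  shows "v # u \<in> set (bads T s n ws)"
  using assms
proof (induction n arbitrary: k ws)
  case 0
  then show ?case
    by simp
next
  case (Suc n)
  define us where "us = concat (map (\<lambda>w. map (\<lambda>v. v # w) [X, Y, Z]) ws)"
  have us: "a # w \<in> set us" if "w \<in> set ws" for a w
    using that by (cases a) (auto simp: us_def)
  have bads: "bads T s (Suc n) ws =
    filter (\<lambda>u. \<not> good T s u \<and> good T s (butlast u)) us @ bads T s n (filter (good T s) us)"
    by (simp add: us_def Let_def)
  show ?case
  proof (cases "length u = k")
    case True
    then have "v # u \<in> set us"
      using Suc.prems(1,3) us by blast
    then show ?thesis
      using Suc.prems(2,4) unfolding bads by simp
  next
    case False
    have "v # u \<in> set (bads T s n (filter (good T s) us))"
    proof (rule Suc.IH[of "Suc k"])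
      fix w
      assume w: "length w = Suc k" "good T s w"
      then obtain a w' where "w = a # w'"
        by (cases w) auto
      moreover from this have "good T s w'"
        using good_sublist[OF w(2)] by (auto simp: sublist_Cons_right)
      ultimately show "w \<in> set (filter (good T s) us)"
        using w Suc.prems(1) us by simp
    qed (use Suc.prems False in auto)
    then show ?thesis
      unfolding bads by simp
  qed
qed

text \<open>Letters are removed at either end as long as the rest stays bad.\<close>

lemma minimal_bad_factor:
  assumes "\<not> good T s w"
  obtains v u where "sublist (v # u) w" "\<not> good T s (v # u)" "good T s u" "good T s (butlast (v # u))"
  using assms
proof (induction "length w" arbitrary: w thesis rule: less_induct)
  case less
  have "w \<noteq> []"
    using less.prems(2) by (auto simp: good_def)
  then obtain v u where w: "w = v # u"
    by (cases w) auto
  show thesis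
  proof (cases "good T s u \<and> good T s (butlast w)")
    case True
    then show ?thesis
      using less.prems(1)[of v u] less.prems(2) w by simp
  next
    case False
    then obtain w' where w': "sublist w' w" "length w' < length w" "\<not> good T s w'"
      using w sublist_butlast[of w] by (metis length_Cons length_butlast lessI diff_less length_greater_0_conv list.distinct(1) sublist_tl list.sel(3) zero_less_one)
    show ?thesis
      by (rule less.hyps[OF w'(2) _ w'(3)], rule less.prems(1))
        (use w'(1) sublist_order.order_trans in blast)+
  qed
qed

lemma bads_complete:
  assumes "\<And>v. s v \<noteq> []" "\<not> good T s w"
  shows "\<exists>q\<in>set (bads T s (Suc (length T)) [[]]). sublist q w"
proof -
  obtain v u where vu: "sublist (v # u) w" "\<not> good T s (v # u)" "good T s u" "good T s (butlast (v # u))"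
    using minimal_bad_factor[OF assms(2)] by blast
  \<comment> \<open>As images are nonempty, a good word is no longer than \<open>T\<close>, which
    bounds the number of levels.\<close>
  have "length u \<le> length (concat (map s u))"
    by (induction u) (use assms(1) in \<open>auto simp: Suc_le_eq add_strict_increasing length_greater_0_conv\<close>)
  also have "\<dots> \<le> length T"
    using vu(3) by (auto simp: good_def dest: sublist_length_le)
  finally have "v # u \<in> set (bads T s (Suc (length T)) [[]])"
    by (intro bads_complete_level[of 0]) (use vu in auto)
  with vu(1) show ?thesis
    by blast
qed

text \<open>
  The search refutes that every entry \<open>(s, qs)\<close> of \<open>tab\<close> has a word of \<open>qs\<close> as a factor of the
  formula. \<open>K\<close> collects the words assumed to be factors so far and serves only to choose the next
  entry; each \<open>c\<close> in \<open>C\<close> stands for the fact that not all words of \<open>c\<close> are factors. Once the branch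
  of \<open>q\<close> is closed, \<open>q\<close> is known not to be a factor, which is the new clause \<open>[q]\<close>.
\<close>

fun search branch where
  "search T tab 0 K C = False"
| "search T tab (Suc n) K C =
    (case List.find (\<lambda>(s, qs). list_all (good T s) K) tab of
      None \<Rightarrow> False
    | Some (s, qs) \<Rightarrow> branch T tab n qs K C)"
| "branch T tab n [] K C = True"
| "branch T tab n (q # qs) K C =
    ((list_ex (list_all (\<lambda>u. sublist u q)) C \<or>
      search T tab n (q # K) (map (filter (\<lambda>u. \<not> sublist u q)) C))
     \<and> branch T tab n qs K ([q] # C))"

text \<open>Success shows that some entry has all its words outside \<open>G\<close>. In a branch,
  unless such an entry exists, the words are refuted one by one, each becoming a clause for the
  next.\<close>

lemma
  fixes G :: "'v list \<Rightarrow> bool"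
  assumes G: "\<And>p q. G q \<Longrightarrow> sublist p q \<Longrightarrow> G p"
  shows search_sound: "search T tab n K C \<Longrightarrow> \<forall>c\<in>set C. \<exists>p\<in>set c. \<not> G p \<Longrightarrow>
      \<exists>(s, qs)\<in>set tab. \<forall>q\<in>set qs. \<not> G q"
    and branch_sound: "branch T tab n qs K C \<Longrightarrow> \<forall>c\<in>set C. \<exists>p\<in>set c. \<not> G p \<Longrightarrow>
      (\<forall>q\<in>set qs. \<not> G q) \<or> (\<exists>(s, qs)\<in>set tab. \<forall>q\<in>set qs. \<not> G q)"
proof (induction T tab n K C and T tab n qs K C rule: search_branch.induct)
  case (2 T tab n K C)
  from "2.prems"(1) obtain s qs where f: "List.find (\<lambda>(s, qs). list_all (good T s) K) tab = Some (s, qs)"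
    and b: "branch T tab n qs K C"
    by (auto split: option.splits)
  from f have "(s, qs) \<in> set tab"
    by (auto simp: find_Some_iff in_set_conv_nth)
  with "2.IH"[OF f refl b "2.prems"(2)] show ?case
    by blast
next
  case (4 T tab n q qs K C)
  show ?case
  proof (cases "\<exists>(s, qs)\<in>set tab. \<forall>q\<in>set qs. \<not> G q")
    case False
    \<comment> \<open>If \<open>G q\<close> held, all factors of \<open>q\<close> would satisfy
      \<open>G\<close>: no clause could consist of them alone, and they may be struck from every
      clause.\<close>
    have q: "\<not> G q"
    proof
      assume "G q"
      then have sub: "G u" if "sublist u q" for u
        using G that by blast
      have "\<not> list_ex (list_all (\<lambda>u. sublist u q)) C"
        using "4.prems"(2) sub by (auto simp: list_ex_iff list_all_iff)
      with "4.prems"(1) have "search T tab n (q # K) (map (filter (\<lambda>u. \<not> sublist u q)) C)"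
        by simp
      moreover have "\<forall>c\<in>set (map (filter (\<lambda>u. \<not> sublist u q)) C). \<exists>p\<in>set c. \<not> G p"
        using "4.prems"(2) sub by fastforce
      ultimately show False
        using "4.IH"(1) False \<open>\<not> list_ex (list_all (\<lambda>u. sublist u q)) C\<close> by blast
    qed
    then have "\<forall>c\<in>set ([q] # C). \<exists>p\<in>set c. \<not> G p"
      using "4.prems"(2) by simp
    with "4.IH"(2) "4.prems"(1) False q show ?thesis
      by auto
  qed blast
qed auto

definition orders :: "(var3 \<times> var3 \<times> var3) list" where
  "orders = [(X,Y,Z), (X,Z,Y), (Y,X,Z), (Y,Z,X), (Z,X,Y), (Z,Y,X)]"

definition clauses :: "(var3 \<Rightarrow> bool) \<Rightarrow> var3 \<times> var3 \<times> var3 \<Rightarrow> (bool \<times> var3 list list) list" where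
  "clauses t = (\<lambda>(x, y, z).
    [(True, [[x,x]]),
     (\<not> t x \<and> \<not> t y, [[x,y,x],[y,x,y]]),
     (t x \<and> t y, [[x,y],[y,x]]),
     (\<not> t x \<and> t y, [[x,y,x]]),
     (t y, [[x,y],[x,z],[y,z]]),
     (\<not> t x \<and> \<not> t z, [[x,y,z,y,x],[z,y,x,y,z]]),
     (\<not> t x \<and> \<not> t y \<and> \<not> t z, [[x,y,z,x],[y,z,x,y],[z,x,y,z]]),
     (\<not> t x \<and> \<not> t y \<and> \<not> t z, [[x,y,z,x],[y,z,x,y],[z,y,z]]),
     (\<not> t x \<and> \<not> t y \<and> \<not> t z, [[x,z,y,x],[y,x,z,y],[z,y,z]]),
     (\<not> t x \<and> \<not> t y \<and> t z, [[x,y,z,x],[y,z,x,y]]),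
     (\<not> t x \<and> t y \<and> t z, [[x,y,z,x]]),
     (t x \<and> t y \<and> t z, [[x,y],[y,z],[z,x]]),
     (\<not> t x \<and> \<not> t y \<and> \<not> t z, [[x,y],[x,z],[y,x],[z,x],[z,y]])])"

definition all_clauses :: "(var3 \<Rightarrow> bool) \<Rightarrow> var3 list list list" where
  "all_clauses t = map snd (filter fst (concat (map (clauses t) orders)))"

text \<open>\<open>n\<close> stands for the number of two-way variables; the default, for none or
  one, is the Zimin word on three letters.\<close>

definition template :: "nat \<Rightarrow> var3 list" where
  "template n = (if n = 3 then [X,Y,Z] else if n = 2 then [X,Y,Z,X,Y] else [X,Y,X,Z,X,Y,X])"

definition marks :: "nat \<Rightarrow> var3 list" where
  "marks n = (if n = 3 then [X,Y,Z] else if n = 2 then [X,Y] else [X])"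

text \<open>
  Images of the three variables up to the order of the variables; two-way variables may only be sent
  to letters in \<open>marks n\<close>, which become single letters in instances of the template.
\<close>

definition images :: "nat \<Rightarrow> (var3 list \<times> var3 list \<times> var3 list) list" where
  "images n =
    (if n = 3 then [([X],[Y],[Z]), ([X],[X],[Y]), ([X],[Y],[Y])]
     else if n = 2 then [([X],[Y],[Z]), ([X],[Y],[Z,X]), ([X],[Y],[Y,Z]), ([X],[X],[Y,Z]), ([X],[Y],[Y,Z,X])]
     else [([X],[Y],[Z]), ([X],[Y],[Z,X]), ([X],[Y],[X,Z]), ([X],[Y],[X,Z,X]), ([X],[Y,X],[Z]),
           ([X],[X,Y],[Z]), ([X],[X],[Y]), ([X],[Y,X],[Z,X]), ([X],[X,Y],[X,Z])])"

definition substs :: "(var3 \<Rightarrow> bool) \<Rightarrow> nat \<Rightarrow> (var3 \<Rightarrow> var3 list) list" where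
  "substs t n =
    filter (\<lambda>s. list_all (\<lambda>v. s v \<noteq> [] \<and> (t v \<longrightarrow> s v \<in> set (map (\<lambda>m. [m]) (marks n)))) [X,Y,Z])
     (concat (map (\<lambda>(a, b, c). map (\<lambda>(x, y, z) v. if v = x then a else if v = y then b else c) orders)
       (images n)))"

text \<open>Concrete predicates for the eight cases, on which \<open>refutes\<close> can be
  evaluated.\<close>

primrec choice :: "bool \<Rightarrow> bool \<Rightarrow> bool \<Rightarrow> var3 \<Rightarrow> bool" where
  "choice a b c X = a"
| "choice a b c Y = b"
| "choice a b c Z = c"

text \<open>The number 8 only bounds the depth of the search; any larger number would do as well.\<close>

definition refutes :: "nat \<Rightarrow> (var3 \<Rightarrow> bool) \<Rightarrow> bool" where
  "refutes n t = search (template n) (map (\<lambda>s. (s, bads (template n) s (Suc (length (template n))) [[]])) (substs t n))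
     8 [] (all_clauses t)"

lemma (in indivisible) all_clauses_excluded:
  "\<forall>c\<in>set (all_clauses two_way). \<exists>p\<in>set c. \<not> occurs_flat p"
proof -
  have "\<exists>p\<in>set c. \<not> occurs_flat p" if "distinct [x, y, z]" "(True, c) \<in> set (clauses two_way (x, y, z))"
    for x y z c
    using that no_xx[OF that(1)] no_xyx_yxy[OF that(1)] no_xy_yx[OF that(1)] no_xyx[OF that(1)]
      no_xy_xz_yz[OF that(1)] no_xyzyx_zyxyz[OF that(1)] no_xyzx_yzxy_zxyz[OF that(1)]
      no_xyzx_yzxy_zyz[OF that(1)] no_xzyx_yxzy_zyz[OF that(1)] no_xyzx_yzxy[OF that(1)]
      no_xyzx[OF that(1)] no_xy_yz_zx[OF that(1)] no_xy_xz_yx_zx_zy[OF that(1)]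
    unfolding clauses_def by (auto simp del: distinct.simps)
  moreover have "distinct [x, y, z]" if "(x, y, z) \<in> set orders" for x y z
    using that by (auto simp: orders_def)
  ultimately show ?thesis
    unfolding all_clauses_def by fastforce
qed

text \<open>The search yields a substitution none of whose minimal bad words occurs; by
  \<open>bads_complete\<close> it maps every occurring word into the template.\<close>

lemma (in indivisible) ex_subst:
  assumes "refutes n two_way"
  obtains s where "\<And>v. s v \<noteq> []" "\<And>v. two_way v \<Longrightarrow> \<exists>m\<in>set (marks n). s v = [m]"
    "\<And>p. occurs_flat p \<Longrightarrow> good (template n) s p"
proof -
  have flat_sublist: "occurs_flat p" if q: "occurs_flat q" and pq: "sublist p q" for p q
  proof -
    obtain r where r: "F r" "map base r = q"
      using q by (auto simp: occurs_flat_def)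
    obtain ys zs where "q = ys @ p @ zs"
      using pq by (auto simp: sublist_def)
    with r(2) have "map base (take (length p) (drop (length ys) r)) = p"
      by (simp flip: take_map drop_map)
    moreover have "F (take (length p) (drop (length ys) r))"
      by (rule F_sublist[OF r(1)]) (rule sublist_order.order_trans[OF sublist_take sublist_drop])
    ultimately show ?thesis
      unfolding occurs_flat_def by blast
  qed
  have "\<exists>(s, qs)\<in>set (map (\<lambda>s. (s, bads (template n) s (Suc (length (template n))) [[]])) (substs two_way n)).
    \<forall>q\<in>set qs. \<not> occurs_flat q"
    by (rule search_sound[OF _ assms[unfolded refutes_def] all_clauses_excluded]) (rule flat_sublist)
  then obtain s where s: "s \<in> set (substs two_way n)"
    and bads: "\<forall>q\<in>set (bads (template n) s (Suc (length (template n))) [[]]). \<not> occurs_flat q"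
    by (auto simp del: bads.simps)
  have s': "s v \<noteq> []" "two_way v \<Longrightarrow> \<exists>m\<in>set (marks n). s v = [m]" for v
    using s by (cases v; auto simp: substs_def)+
  moreover have "good (template n) s p" if "occurs_flat p" for p
    using bads_complete[of s "template n" p] bads s'(1) that flat_sublist
    by blast
  ultimately show thesis
    using that by blast
qed

text \<open>The marks do not affect the composition of \<open>s\<close> and \<open>\<tau>\<close>: a
  one-way variable has a single orientation, and a two-way variable becomes a single letter, equal
  to its mirror image.\<close>

lemma (in indivisible) occurs_if_good:
  assumes s: "\<And>v. s v \<noteq> []" "\<And>v. two_way v \<Longrightarrow> \<exists>m\<in>set M. s v = [m]"
    and good: "\<And>p. occurs_flat p \<Longrightarrow> good T s p"
    and \<tau>: "\<And>v. \<tau> v \<noteq> []" "\<And>v. set (\<tau> v) \<subseteq> A" "\<And>m. m \<in> set M \<Longrightarrow> length (\<tau> m) = 1"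
    and T: "sublist (concat (map \<tau> T)) w"
  shows "occurs_in A \<psi> w"
proof -
  define u where "u v = concat (map \<tau> (s v))" for v
  \<comment> \<open>Reading forwards along \<open>orient\<close> also serves variables that occur
    only reversed.\<close>
  define h where "h l = (if l = orient (base l) then u (base l) else rev (u (base l)))" for l
  define f where "f p = concat (map h p)" for p
  have u: "u v \<noteq> []" "set (u v) \<subseteq> A" for v
    using s(1)[of v] \<tau>(1,2) by (auto simp: u_def neq_Nil_conv)
  have "h (Rev v) = rev (h (Var v))" for v
    by (cases "orient v = Var v") (auto simp: h_def orient_def split: if_splits)
  then have "respects_reversal f"
    by (simp add: respects_reversal_def f_def)
  moreover have "word_morphism f"
    by (simp add: word_morphism_def f_def)
  moreover have "non_erasing f"
    using u(1) by (simp add: non_erasing_def f_def h_def)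
  moreover have "set (h l) \<subseteq> A" for l
    using u(2) by (auto simp: h_def)
  then have "range f \<subseteq> lists A"
    by (force simp: f_def lists_eq_set)
  moreover have "sublist (f p) w" if p: "p \<in> \<psi>" for p
  proof -
    have F: "F p"
      using p by (auto simp: factor_of_formula_def)
    have "h l = u (base l)" if l: "l \<in> set p" for l
    proof (cases "l = orient (base l)")
      case False
      then have "two_way (base l)"
        using one_way_letter[OF F l] by blast
      then obtain m where "m \<in> set M" "s (base l) = [m]"
        using s(2) by blast
      then have "length (u (base l)) = 1"
        using \<tau>(3) by (simp add: u_def)
      then have "rev (u (base l)) = u (base l)"
        by (cases "u (base l)") auto
      with False show ?thesis
        by (simp add: h_def)
    qed (simp add: h_def)
    then have "f p = concat (map u (map base p))"
      unfolding f_def by (auto intro!: arg_cong[where f = concat])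
    also have "\<dots> = concat (map \<tau> (concat (map s (map base p))))"
      unfolding u_def by (induction p) simp_all
    finally have "f p = concat (map \<tau> (concat (map s (map base p))))" .
    moreover have "occurs_flat (map base p)"
      using F by (auto simp: occurs_flat_def)
    then have "sublist (concat (map s (map base p))) T"
      using good unfolding good_def by blast
    ultimately show ?thesis
      using sublist_order.order_trans[OF sublist_concat_map T] by simp
  qed
  ultimately show ?thesis
    unfolding occurs_in_def by blast
qed

section \<open>Instances of the templates in long words\<close>

lemma ex_repeated_block:
  fixes A :: "'a set"
  assumes "finite A"
  shows "\<exists>N. \<forall>w\<in>lists A. N \<le> length w \<longrightarrow>
    (\<exists>u v. length u = L \<and> v \<noteq> [] \<and> sublist (u @ v @ u) w)"
proof -
  define B where "B = {u. set u \<subseteq> A \<and> length u = L}"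
  have B: "finite B"
    unfolding B_def by (rule finite_lists_length_eq[OF assms])
  have "\<exists>u v. length u = L \<and> v \<noteq> [] \<and> sublist (u @ v @ u) w"
    if w: "w \<in> lists A" "Suc (card B) * Suc L \<le> length w" for w
  proof -
    \<comment> \<open>Among \<open>card B + 1\<close> blocks two coincide. They start at multiples
      of \<open>Suc L\<close>, which leaves at least one letter between them for
      \<open>v\<close>.\<close>
    define blk where "blk i = take L (drop (i * Suc L) w)" for i
    have le: "i * Suc L + Suc L \<le> length w" if i: "i \<le> card B" for i
    proof -
      have "Suc i * Suc L \<le> Suc (card B) * Suc L"
        using i by (intro mult_le_mono1) simp
      with w(2) show ?thesis
        by simp
    qed
    have "blk ` {..card B} \<subseteq> B"
    proof (intro image_subsetI)
      fix i
      assume "i \<in> {..card B}"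
      then have "length (blk i) = L"
        using le[of i] by (simp add: blk_def)
      moreover have "set (blk i) \<subseteq> A"
        using w(1) by (auto simp: blk_def dest!: in_set_takeD in_set_dropD)
      ultimately show "blk i \<in> B"
        by (simp add: B_def)
    qed
    then have "card (blk ` {..card B}) < card {..card B}"
      using card_mono[OF B] by (simp add: less_Suc_eq_le)
    then have "\<not> inj_on blk {..card B}"
      by (rule pigeonhole)
    then obtain i j where ij: "i < j" "j \<le> card B" "blk i = blk j"
      unfolding inj_on_def by (metis atMost_iff linorder_neqE_nat)
    define u v where "u = blk i" and "v = take (j * Suc L - (i * Suc L + L)) (drop (i * Suc L + L) w)"
    have "Suc i * Suc L \<le> j * Suc L"
      using ij(1) by (intro mult_le_mono1) simp
    then have iL: "i * Suc L + L < j * Suc L"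
      by simp
    have "drop (i * Suc L) w = blk i @ drop (i * Suc L + L) w"
      by (metis blk_def append_take_drop_id drop_drop add.commute)
    also have "drop (i * Suc L + L) w = v @ drop (j * Suc L) w"
      using iL by (metis v_def append_take_drop_id drop_drop add.commute le_add_diff_inverse2 less_imp_le_nat)
    also have "drop (j * Suc L) w = blk j @ drop (j * Suc L + L) w"
      by (metis blk_def append_take_drop_id drop_drop add.commute)
    finally have "w = take (i * Suc L) w @ (u @ v @ u) @ drop (j * Suc L + L) w"
      using ij(3) by (metis append.assoc append_take_drop_id u_def)
    then have "sublist (u @ v @ u) w"
      by (metis sublist_appendI)
    moreover have "length u = L"
      using le[of i] ij(1,2) by (simp add: u_def blk_def)
    moreover have "v \<noteq> []"
      using iL le[OF ij(2)] by (simp add: v_def)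
    ultimately show ?thesis
      by blast
  qed
  then show ?thesis
    by blast
qed

lemma ex_template:
  assumes A: "finite A"
  shows "\<exists>N. \<forall>w\<in>lists A. N \<le> length w \<longrightarrow>
    (\<exists>\<tau>. (\<forall>v. \<tau> v \<noteq> [] \<and> set (\<tau> v) \<subseteq> A) \<and> (\<forall>m\<in>set (marks n). length (\<tau> m) = 1) \<and>
      sublist (concat (map \<tau> (template n))) w)"
proof -
  have sets: "set u \<subseteq> A" if "sublist u w" "w \<in> lists A" for u w
    using that by (auto simp: sublist_def)
  consider "n = 3" | "n = 2" | "n \<noteq> 3" "n \<noteq> 2"
    by blast
  then show ?thesis
  proof cases
    case 1
    show ?thesis
    proof (intro exI[of _ 3] ballI impI)
      fix w
      assume w: "w \<in> lists A" "3 \<le> length w"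
      then obtain a b c w' where "w = a # b # c # w'"
        by (metis Suc_le_length_iff numeral_3_eq_3)
      with w(1) 1 show "\<exists>\<tau>. (\<forall>v. \<tau> v \<noteq> [] \<and> set (\<tau> v) \<subseteq> A) \<and> (\<forall>m\<in>set (marks n). length (\<tau> m) = 1) \<and>
        sublist (concat (map \<tau> (template n))) w"
        by (intro exI[of _ "\<lambda>v. case v of X \<Rightarrow> [a] | Y \<Rightarrow> [b] | Z \<Rightarrow> [c]"])
          (auto simp: marks_def template_def sublist_code split: var3.split)
    qed
  next
    case 2
    obtain N where N: "\<And>w. w \<in> lists A \<Longrightarrow> N \<le> length w \<Longrightarrow>
      \<exists>u v. length u = 2 \<and> v \<noteq> [] \<and> sublist (u @ v @ u) w"
      using ex_repeated_block[OF A, of 2] by blast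
    show ?thesis
    proof (intro exI[of _ N] ballI impI)
      fix w
      assume w: "w \<in> lists A" "N \<le> length w"
      then obtain u v where u: "length u = 2" "v \<noteq> []" "sublist (u @ v @ u) w"
        using N by blast
      then obtain a b where ab: "u = [a, b]"
        by (metis (no_types) Suc_length_conv length_0_conv numeral_2_eq_2)
      define \<tau> where "\<tau> y = (case y of X \<Rightarrow> [a] | Y \<Rightarrow> [b] | Z \<Rightarrow> v)" for y
      have "\<tau> y \<noteq> [] \<and> set (\<tau> y) \<subseteq> A" for y
        using u(2) ab sets[OF u(3) w(1)] by (cases y) (simp_all add: \<tau>_def)
      moreover have "concat (map \<tau> (template n)) = u @ v @ u"
        using 2 by (simp add: template_def \<tau>_def ab)
      moreover have "\<forall>m\<in>set (marks n). length (\<tau> m) = 1"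
        using 2 by (simp add: marks_def \<tau>_def)
      ultimately show "\<exists>\<tau>. (\<forall>v. \<tau> v \<noteq> [] \<and> set (\<tau> v) \<subseteq> A) \<and> (\<forall>m\<in>set (marks n). length (\<tau> m) = 1) \<and>
        sublist (concat (map \<tau> (template n))) w"
        using u(3) by (intro exI[of _ \<tau>]) simp
    qed
  next
    case 3
    obtain M where M: "\<And>w. w \<in> lists A \<Longrightarrow> M \<le> length w \<Longrightarrow>
      \<exists>u v. length u = 1 \<and> v \<noteq> [] \<and> sublist (u @ v @ u) w"
      using ex_repeated_block[OF A, of 1] by blast
    \<comment> \<open>The repeated block has length \<open>M\<close> and so contains some
      \<open>a x a\<close> itself, as in the recursion of Zimin words.\<close>
    obtain N where N: "\<And>w. w \<in> lists A \<Longrightarrow> N \<le> length w \<Longrightarrow>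
      \<exists>u v. length u = M \<and> v \<noteq> [] \<and> sublist (u @ v @ u) w"
      using ex_repeated_block[OF A, of M] by blast
    show ?thesis
    proof (intro exI[of _ N] ballI impI)
      fix w
      assume w: "w \<in> lists A" "N \<le> length w"
      then obtain u v where u: "length u = M" "v \<noteq> []" "sublist (u @ v @ u) w"
        using N by blast
      have "u \<in> lists A"
        using sets[OF u(3) w(1)] by auto
      then obtain a0 x where a0: "length a0 = 1" "x \<noteq> []" "sublist (a0 @ x @ a0) u"
        using M u(1) by blast
      then obtain a where a: "a0 = [a]"
        by (metis One_nat_def Suc_length_conv length_0_conv)
      obtain p q where pq: "u = p @ ([a] @ x @ [a]) @ q"
        using a0(3) a by (auto simp: sublist_def)
      \<comment> \<open>The end \<open>q\<close> of the first block and the start \<open>p\<close>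
        of the second are absorbed, with \<open>v\<close>, into the image of
        \<open>Z\<close>.\<close>
      have "u @ v @ u = p @ ([a] @ x @ [a] @ (q @ v @ p) @ [a] @ x @ [a]) @ q"
        by (simp add: pq)
      then have "sublist ([a] @ x @ [a] @ (q @ v @ p) @ [a] @ x @ [a]) (u @ v @ u)"
        by (simp only: sublist_appendI)
      then have s: "sublist ([a] @ x @ [a] @ (q @ v @ p) @ [a] @ x @ [a]) w"
        using u(3) by (rule sublist_order.order_trans)
      define \<tau> where "\<tau> y = (case y of X \<Rightarrow> [a] | Y \<Rightarrow> x | Z \<Rightarrow> q @ v @ p)" for y
      have "\<tau> y \<noteq> [] \<and> set (\<tau> y) \<subseteq> A" for y
        using u(2) a0(2) sets[OF s w(1)] by (cases y) (simp_all add: \<tau>_def)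
      moreover have "concat (map \<tau> (template n)) = [a] @ x @ [a] @ (q @ v @ p) @ [a] @ x @ [a]"
        using 3 by (simp add: template_def \<tau>_def)
      moreover have "\<forall>m\<in>set (marks n). length (\<tau> m) = 1"
        using 3 by (simp add: marks_def \<tau>_def)
      ultimately show "\<exists>\<tau>. (\<forall>v. \<tau> v \<noteq> [] \<and> set (\<tau> v) \<subseteq> A) \<and> (\<forall>m\<in>set (marks n). length (\<tau> m) = 1) \<and>
        sublist (concat (map \<tau> (template n))) w"
        using s by (intro exI[of _ \<tau>]) simp
    qed
  qed
qed

lemma (in indivisible) not_avoidable:
  assumes "refutes n two_way"
  shows "\<not> avoidable \<psi>"
proof
  assume "avoidable \<psi>"
  then obtain k where k: "k_avoidable k \<psi>"
    by (auto simp: avoidable_def)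
  obtain s where s: "\<And>v. s v \<noteq> []" "\<And>v. two_way v \<Longrightarrow> \<exists>m\<in>set (marks n). s v = [m]"
    "\<And>p. occurs_flat p \<Longrightarrow> good (template n) s p"
    using ex_subst[OF assms] by blast
  obtain N where N: "\<And>w. w \<in> lists {..<k} \<Longrightarrow> N \<le> length w \<Longrightarrow>
    \<exists>\<tau>. (\<forall>v. \<tau> v \<noteq> [] \<and> set (\<tau> v) \<subseteq> {..<k}) \<and> (\<forall>m\<in>set (marks n). length (\<tau> m) = 1) \<and>
      sublist (concat (map \<tau> (template n))) w"
    using ex_template[of "{..<k}" n] by blast
  have "length w \<le> N" if w: "w \<in> lists {..<k}" "avoids {..<k} w \<psi>" for w
  proof (rule ccontr)
    assume "\<not> length w \<le> N"
    then obtain \<tau> where "\<And>v. \<tau> v \<noteq> []" "\<And>v. set (\<tau> v) \<subseteq> {..<k}"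
      "\<And>m. m \<in> set (marks n) \<Longrightarrow> length (\<tau> m) = 1" "sublist (concat (map \<tau> (template n))) w"
      using N[OF w(1)] by auto
    from occurs_if_good[OF s this] w(2) show False
      by (simp add: avoids_def)
  qed
  then have "{w \<in> lists {..<k}. avoids {..<k} w \<psi>} \<subseteq> {w. set w \<subseteq> {..<k} \<and> length w \<le> N}"
    by auto
  with k finite_lists_length_le[of "{..<k}" N] show False
    unfolding k_avoidable_def using finite_subset by blast
qed

section \<open>The basis property\<close>

text \<open>\<open>refutes_0\<close> to \<open>refutes_3\<close> settle the eight distributions of
  two-way variables by evaluation.\<close>

lemma refutes_0: "refutes 0 (choice False False False)"
  by code_simp

lemma refutes_1:
  "refutes 1 (choice True False False)"
  "refutes 1 (choice False True False)"
  "refutes 1 (choice False False True)"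
  by code_simp+

lemma refutes_2:
  "refutes 2 (choice True True False)"
  "refutes 2 (choice True False True)"
  "refutes 2 (choice False True True)"
  by code_simp+

lemma refutes_3: "refutes 3 (choice True True True)"
  by code_simp

lemma ex_refutes: "\<exists>n. refutes n t"
proof -
  have "t = choice (t X) (t Y) (t Z)"
    by (rule ext) (metis choice.simps var3.exhaust)
  then show ?thesis
    using refutes_0 refutes_1 refutes_2 refutes_3
    by (cases "t X"; cases "t Y"; cases "t Z") (simp_all only:, blast+)
qed

lemma Phi3_complete:
  assumes "avoidable \<psi>"
  shows "\<exists>\<phi>\<in>Phi3. e_divides \<phi> \<psi>"
proof (rule ccontr)
  assume "\<not> ?thesis"
  then interpret indivisible \<psi>
    by unfold_locales blast
  show False
    using ex_refutes[of two_way] not_avoidable assms by blast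
qed

section \<open>Independence of the formulas of the list\<close>

lemma e_dividesE:
  fixes \<phi> \<psi> :: "var3 formula"
  assumes "e_divides \<phi> \<psi>"
  obtains a b c where "distinct [base a, base b, base c]"
    "\<And>p. p \<in> \<phi> \<Longrightarrow> factor_of_formula (map (inst a b c) p) \<psi>"
proof -
  obtain h where h: "word_morphism h" "inj h" "respects_d_reversal h" "\<And>l. length (h [l]) = 1"
    "\<And>p. p \<in> \<phi> \<Longrightarrow> factor_of_formula (h p) \<psi>"
    using assms by (auto simp: e_divides_def)
  have "\<exists>a. h [l] = [a]" for l
    using h(4)[of l] by (cases "h [l]") auto
  then obtain g where g: "\<And>l. h [l] = [g l]"
    by metis
  have rev: "g (Rev v) = bar (g (Var v))" for v
    using h(3) by (simp add: respects_d_reversal_def g)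
  have inj: "g l = g m \<Longrightarrow> l = m" for l m
    using injD[OF h(2), of "[l]" "[m]"] by (simp add: g)
  \<comment> \<open>If the images shared a variable, \<open>Var v\<close> would have the same image
    as \<open>Var w\<close> or \<open>Rev w\<close>, against injectivity.\<close>
  have "base (g (Var v)) \<noteq> base (g (Var w))" if "v \<noteq> w" for v w
    using that inj[of "Var v" "Var w"] inj[of "Var v" "Rev w"] by (auto simp: base_eq_iff rev)
  then have "distinct [base (g (Var X)), base (g (Var Y)), base (g (Var Z))]"
    by simp
  moreover have "inst (g (Var X)) (g (Var Y)) (g (Var Z)) l = g l" for l
    by (cases l) (auto simp: rev split: var3.split)
  then have "map (inst (g (Var X)) (g (Var Y)) (g (Var Z))) p = h p" for p
    by (subst morphism_letters[OF h(1)]) (simp add: g concat_map_singleton)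
  ultimately show thesis
    using that h(5) by metis
qed

definition letters :: "var3 letter list" where
  "letters = [Var X, Var Y, Var Z, Rev X, Rev Y, Rev Z]"

definition frames :: "(var3 letter \<times> var3 letter \<times> var3 letter) list" where
  "frames = filter (\<lambda>(a, b, c). distinct [base a, base b, base c])
     (List.product letters (List.product letters letters))"

text \<open>An executable copy of \<open>Phi3\<close>, which turns independence into a finite check
  by evaluation.\<close>

definition Phi3_list :: "var3 pattern list list" where
  "Phi3_list =
    (let x = Var X; y = Var Y; z = Var Z; x' = Rev X; y' = Rev Y; z' = Rev Z in
     [[[x,x]],
      [[x,x']],
      [[x,y,x], [y,x,y]],
      [[x,y], [y,x], [x'], [y']],
      [[x,y], [y,x'], [y']],
      [[x,y], [y',x']],
      [[x,y,x], [y']],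
      [[x,y], [x,z], [y',z]],
      [[x,y'], [y,z'], [z,x']],
      [[x,y,z,y,x], [z,y,x,y,z]],
      [[x,y,z,y,x], [z,y,x,y',z]],
      [[x,y,z,y,x], [z,y',x,y,z]],
      [[x,y,z,y,x], [z,y',x,y',z]],
      [[x,y,z,y',x], [z,y,x,y',z]],
      [[x,y,z,y',x], [z,y',x,y,z]],
      [[x,y], [x,z], [y,z], [y']],
      [[x,y], [x,z], [y',z']],
      [[y,x], [z,x], [z',y']],
      [[x,y], [x,z], [y,z'], [y']],
      [[y,x], [z,x], [z',y], [y']],
      [[x,y], [x',z'], [y,z], [y']],
      [[x,y], [x',z'], [y',z]],
      [[x,y,z,x], [y,z,x,y], [z,x,y,z]],
      [[x,y,z,x], [y,z,x,y], [z,y,z]],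
      [[x,z,y,x], [y,x,z,y], [z,y,z]],
      [[x,y,z,x], [y,z,x,y], [z']],
      [[x,y,z,x], [y,z',x,y]],
      [[x,y], [x,z], [y,x], [z,x], [z,y]],
      [[x,y], [y,z], [z,x], [x'], [y'], [z']],
      [[x,y], [y,z], [z,x'], [y'], [z']],
      [[x,y], [y,z], [z',x'], [y']],
      [[x,y,z,x], [y'], [z']]])"

definition instances :: "var3 pattern list \<Rightarrow> var3 pattern list list" where
  "instances ps = map (\<lambda>(a, b, c). map (map (inst a b c)) ps) frames"

definition divides_none :: "var3 pattern list list \<Rightarrow> var3 pattern list \<Rightarrow> var3 pattern list list \<Rightarrow> bool" where
  "divides_none iss ps = list_all (\<lambda>qs. qs = ps \<or> \<not> list_ex (list_all (\<lambda>p. list_ex (sublist p) qs)) iss)"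

lemma Phi3_list: "set (map set Phi3_list) = Phi3"
  by (simp add: Phi3_list_def Phi3_def Let_def insert_commute)

lemma Phi3_list_independent: "list_all (\<lambda>ps. divides_none (instances ps) ps Phi3_list) Phi3_list"
  by code_simp

lemma Phi3_independent:
  assumes "\<phi> \<in> Phi3" "\<psi> \<in> Phi3" "e_divides \<phi> \<psi>"
  shows "\<phi> = \<psi>"
proof -
  obtain ps qs where ps: "\<phi> = set ps" "ps \<in> set Phi3_list" and qs: "\<psi> = set qs" "qs \<in> set Phi3_list"
    using assms(1,2) unfolding Phi3_list[symmetric] by auto
  obtain a b c where abc: "distinct [base a, base b, base c]"
    "\<And>p. p \<in> \<phi> \<Longrightarrow> factor_of_formula (map (inst a b c) p) \<psi>"
    using e_dividesE[OF assms(3)] by blast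
  have "l \<in> set letters" for l
    by (cases l; cases "base l") (auto simp: letters_def)
  with abc(1) have "(a, b, c) \<in> set frames"
    by (simp add: frames_def del: distinct.simps)
  then have "map (map (inst a b c)) ps \<in> set (instances ps)"
    by (force simp: instances_def)
  moreover have "list_all (\<lambda>p. list_ex (sublist p) qs) (map (map (inst a b c)) ps)"
    using abc(2) by (auto simp: ps qs factor_of_formula_def list_all_iff list_ex_iff)
  ultimately have "qs = ps"
    using Phi3_list_independent ps(2) qs(2) unfolding divides_none_def list_all_iff list_ex_iff by blast
  then show ?thesis
    by (simp add: ps qs)
qed

theorem theorem4p2: "avoidance_basis 3 Phi3"
proof -
  have "finite \<phi>" if "\<phi> \<in> Phi3" for \<phi>
    using that unfolding Phi3_list[symmetric] by auto
  moreover have "CARD(var3) = 3"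
    by (simp add: UNIV_var3)
  ultimately show ?thesis
    unfolding avoidance_basis_def is_formula_def
    using Phi3_avoidable Phi3_complete Phi3_independent by blast
qed

end
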